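(* Let $\gamma>1$. There is a constant $C(\gamma)>0$, depending only on $\gamma$ and having the property (WS) stated in the context, such that the following holds. Let $0<T<\infty$ and let $(\rho,u)$ be an entropy-admissible weak solution on $S_T$ of the compressible Euler equations with pressure $p(\rho)=\gamma^{-1}\rho^\gamma$ and initial data $(\rho_0,u_0)$. Assume $\|\rho^{-1}\|_{L^\infty(S_T)}<\infty$, let $m>0$ satisfy $$\|\rho^{-1}(\rho-1)\|_{L^\infty(S_T)}+\|u\|_{L^\infty(S_T)}\le m,$$ and let $c_0=1+C(\gamma)m$. If for some $R>0$ the initial disturbance satisfies $$\operatorname{ess\,supp}(\rho_0-1,u_0)\subset\{x\in\mathbb{R}^3:|x|\le R\},$$ then the disturbance satisfies $$\operatorname{ess\,supp}(\rho-1,u)\subset\{(t,x)\in S_T:|x|\le R+c_0t\}.$$ More generally, let $0<\sigma<T$ be a Lebesgue time for $(\rho,u)$, and let $(\rho_\sigma,u_\sigma)$ denote the corresponding Lebesgue value. If for some $R>0$ $$\operatorname{ess\,supp}(\rho_\sigma-1,u_\sigma)\subset\{x\in\mathbb{R}^3:|x|\le R\},$$ then $$\operatorname{ess\,supp}(\rho-1,u)\cap\bigl((\sigma,T)\times\mathbb{R}^3\bigr)\subset\bigl\{(t,x)\in(\sigma,T)\times\mathbb{R}^3:|x|\le R+c_0(t-\sigma)\bigr\}.$$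
   Context: For $0<T<\infty$ set $S_T=[0,T)\times\mathbb{R}^3$. The compressible Euler equations are $\partial_t\rho+\nabla\cdot(\rho u)=0$, $\partial_t(\rho u)+\nabla\cdot(\rho u\otimes u)+\nabla p(\rho)=0$, with $p(\rho)=\gamma^{-1}\rho^\gamma$, $\gamma>1$. The background density is $1$, with sound speed $p'(1)^{1/2}=1$. Weak solution: $(\rho,u)$ is a weak solution on $S_T$ with initial data $(\rho_0,u_0)$ if $(\rho,u)\in L^\infty(S_T;\mathbb{R}_{>0}\times\mathbb{R}^3)$, $(\rho_0,u_0)\in L^\infty(\mathbb{R}^3;\mathbb{R}_{>0}\times\mathbb{R}^3)$ (positivity of $\rho,\rho_0$ is understood almost everywhere), and $$\iint_{S_T}(\rho\,\partial_t\varphi+\rho u\cdot\nabla_x\varphi)\,dx\,dt+\int_{\mathbb{R}^3}\rho_0\,\varphi(0,\cdot)\,dx=0,$$ $$\iint_{S_T}\bigl(\rho u\cdot\partial_t\psi+\rho\langle u\otimes u,\nabla_x\psi\rangle+\tfrac1\gamma\rho^\gamma\,\nabla_x\cdot\psi\bigr)dx\,dt+\int_{\mathbb{R}^3}\rho_0u_0\cdot\psi(0,\cdot)\,dx=0$$ for all $(\varphi,\psi)\in C^{0,1}_0(S_T;\mathbb{R}\times\mathbb{R}^3)$, i.e. all Lipschitz pairs with compact support in $S_T=[0,T)\times\mathbb{R}^3$ (so they need not vanish at $t=0$). Entropy-admissible: a weak solution is entropy-admissible if in addition $$\iint_{S_T}\Bigl[\bigl(\tfrac12\rho|u|^2+\tfrac1{\gamma(\gamma-1)}\rho^\gamma\bigr)\partial_t\varphi+\bigl(\tfrac12\rho|u|^2+\tfrac1{\gamma-1}\rho^\gamma\bigr)u\cdot\nabla_x\varphi\Bigr]dx\,dt+\int_{\mathbb{R}^3}\bigl(\tfrac12\rho_0|u_0|^2+\tfrac1{\gamma(\gamma-1)}\rho_0^\gamma\bigr)\varphi(0,\cdot)\,dx\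 \ge\ 0$$ for all nonnegative $\varphi\in C^{0,1}_0(S_T;\mathbb{R}_{\ge0})$ (compactly supported Lipschitz). Lebesgue time and value: $\sigma\in(0,T)$ is a Lebesgue time for $(\rho,u)$, with Lebesgue value $(\rho_\sigma,u_\sigma)\in L^\infty(\mathbb{R}^3;\mathbb{R}_{>0}\times\mathbb{R}^3)$, if for every compact $K\subset\mathbb{R}^3$ $$\lim_{h\downarrow0}\frac1{2h}\int_{\sigma-h}^{\sigma+h}\|(\rho(t,\cdot),u(t,\cdot))-(\rho_\sigma,u_\sigma)\|_{L^1(K)}\,dt=0.$$ $\operatorname{ess\,supp}$ denotes the essential support: the complement (in the domain) of the largest relatively open set on which the function vanishes a.e. Property (WS) of $C(\gamma)$: for every $0<T<\infty$, every entropy-admissible weak solution $(\rho,u)$ on $S_T$ with initial data $(\rho_0,u_0)$ and $\|\rho^{-1}\|_{L^\infty(S_T)}<\infty$, every $m>0$ with $\|\rho^{-1}(\rho-1)\|_{L^\infty(S_T)}+\|u\|_{L^\infty(S_T)}\le m$, and every nonempty closed bounded set $V\subset\mathbb{R}^3$ with Lipschitz boundary such that $F(0;V):=\|\rho_0^{-1}(\rho_0-1)\|_{L^\infty(V)}+\|u_0\|_{L^\infty(V)}=0$, one has $\sup\{0\le\alpha\le1:F(\alpha;V)=0\}\ge(1+C(\gamma)m)^{-1}$, where for $0<\alpha\le1$, $F(\alpha;V)=\|\rho^{-1}(\rho-1)\|_{L^\infty(V_\alpha)}+\|u\|_{L^\infty(V_\alpha)}$, $V_\alpha=\operatorname{supp}d_\alpha\cap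 S_T$ and $d_\alpha(t,x)=(\operatorname{dist}(x,\mathbb{R}^3\setminus V)-t/\alpha)_+$. *)

theory Defs
  imports "HOL-Analysis.Analysis" "HOL-Probability.Essential_Supremum"
begin

type_synonym space = "real^3"
type_synonym spacetime = "real \<times> (real^3)"

definition slab :: "real \<Rightarrow> spacetime set" where
  "slab T = {0..<T} \<times> UNIV"

definition Linf_norm :: "'a::euclidean_space set \<Rightarrow> ('a \<Rightarrow> 'b::real_normed_vector) \<Rightarrow> ennreal" where
  "Linf_norm S f = esssup (lebesgue_on S) (\<lambda>z. ennreal (norm (f z)))"

(* (r, v) is in L^infinity(S; R_{>0} x R^3), with positivity almost everywhere. *)
definition Linf_state :: "'a::euclidean_space set \<Rightarrow> ('a \<Rightarrow> real) \<Rightarrow> ('a \<Rightarrow> space) \<Rightarrow> bool" where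
  "Linf_state S r v \<longleftrightarrow>
     r \<in> borel_measurable (lebesgue_on S) \<and> v \<in> borel_measurable (lebesgue_on S) \<and>
     Linf_norm S r < \<infinity> \<and> Linf_norm S v < \<infinity> \<and> (AE z in lebesgue_on S. r z > 0)"

definition ess_supp :: "'a::euclidean_space set \<Rightarrow> ('a \<Rightarrow> 'b::real_normed_vector) \<Rightarrow> 'a set" where
  "ess_supp S f =
     S - \<Union>{U. openin (top_of_set S) U \<and> (AE z in lebesgue_on U. f z = 0)}"

(* The union subtracted in ess_supp is itself relatively open, and by the next lemma f vanishes
   almost everywhere on it; so it is the largest such set. *)
lemma AE_zero_largest_openin:
  fixes S :: "'a::euclidean_space set" and f :: "'a \<Rightarrow> 'b::real_normed_vector"
  assumes S: "S \<in> sets lebesgue"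
  defines "W \<equiv> \<Union>{U. openin (top_of_set S) U \<and> (AE z in lebesgue_on U. f z = 0)}"
  shows "openin (top_of_set S) W" and "AE z in lebesgue_on W. f z = 0"
proof -
  let ?F = "{U. openin (top_of_set S) U \<and> (AE z in lebesgue_on U. f z = 0)}"
  show W: "openin (top_of_set S) W"
    unfolding W_def by (rule openin_Union) auto
  have meas: "U \<in> sets lebesgue" if "openin (top_of_set S) U" for U
    using that S by (auto simp: openin_open)
  obtain G where G: "G \<subseteq> ?F" "countable G" "\<Union>G = W"
    unfolding W_def by (rule Lindelof_openin[of ?F S]) auto
  have "AE z in lebesgue. \<forall>U\<in>G. z \<in> U \<longrightarrow> f z = 0"
  proof (rule AE_ball_countable'[OF _ G(2)])
    fix U assume "U \<in> G"
    then have "openin (top_of_set S) U" "AE z in lebesgue_on U. f z = 0"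
      using G(1) by auto
    then show "AE z in lebesgue. z \<in> U \<longrightarrow> f z = 0"
      using meas[of U] by (simp add: AE_restrict_space_iff)
  qed
  then have "AE z in lebesgue. z \<in> W \<longrightarrow> f z = 0"
    by (rule eventually_mono) (use G(3) in auto)
  then show "AE z in lebesgue_on W. f z = 0"
    using meas[OF W] by (simp add: AE_restrict_space_iff)
qed

(* Classical pointwise partial derivatives.  They are only applied to functions that are Lipschitz
   on the slab, hence differentiable at almost every point of it (Rademacher); the arbitrary
   values at the exceptional points, including those with t = 0, do not affect the integrals. *)
definition dt :: "(spacetime \<Rightarrow> 'b::real_normed_vector) \<Rightarrow> spacetime \<Rightarrow> 'b" where
  "dt f z = vector_derivative (\<lambda>s. f (s, snd z)) (at (fst z))"

definition dx :: "3 \<Rightarrow> (spacetime \<Rightarrow> 'b::real_normed_vector) \<Rightarrow> spacetime \<Rightarrow> 'b" where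
  "dx i f z = vector_derivative (\<lambda>s. f (fst z, snd z + s *\<^sub>R axis i 1)) (at 0)"

definition grad :: "(spacetime \<Rightarrow> real) \<Rightarrow> spacetime \<Rightarrow> space" where
  "grad f z = (\<chi> i. dx i f z)"

definition divergence :: "(spacetime \<Rightarrow> space) \<Rightarrow> spacetime \<Rightarrow> real" where
  "divergence f z = (\<Sum>i\<in>UNIV. dx i f z $ i)"

(* Only the restriction to the slab matters; the support may meet {t = 0} but not {t = T}. *)
definition test_fun :: "real \<Rightarrow> (spacetime \<Rightarrow> 'b::real_normed_vector) \<Rightarrow> bool" where
  "test_fun T f \<longleftrightarrow>
     (\<exists>L. L-lipschitz_on (slab T) f) \<and>
     (\<exists>K. compact K \<and> K \<subseteq> slab T \<and> (\<forall>z\<in>slab T - K. f z = 0))"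

definition weak_solution ::
    "real \<Rightarrow> real \<Rightarrow> (spacetime \<Rightarrow> real) \<Rightarrow> (spacetime \<Rightarrow> space) \<Rightarrow>
     (space \<Rightarrow> real) \<Rightarrow> (space \<Rightarrow> space) \<Rightarrow> bool" where
  "weak_solution \<gamma> T \<rho> u \<rho>\<^sub>0 u\<^sub>0 \<longleftrightarrow>
     Linf_state (slab T) \<rho> u \<and> Linf_state UNIV \<rho>\<^sub>0 u\<^sub>0 \<and>
     (\<forall>\<phi> :: spacetime \<Rightarrow> real. test_fun T \<phi> \<longrightarrow>
        (LINT z|lebesgue_on (slab T). \<rho> z * dt \<phi> z + \<rho> z * (u z \<bullet> grad \<phi> z))
        + (LINT x|lebesgue. \<rho>\<^sub>0 x * \<phi> (0, x)) = 0) \<and>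
     (\<forall>\<psi> :: spacetime \<Rightarrow> space. test_fun T \<psi> \<longrightarrow>
        (LINT z|lebesgue_on (slab T).
            \<rho> z * (u z \<bullet> dt \<psi> z)
            + \<rho> z * (\<Sum>i\<in>UNIV. \<Sum>j\<in>UNIV. u z $ i * u z $ j * dx j \<psi> z $ i)
            + 1 / \<gamma> * \<rho> z powr \<gamma> * divergence \<psi> z)
        + (LINT x|lebesgue. \<rho>\<^sub>0 x * (u\<^sub>0 x \<bullet> \<psi> (0, x))) = 0)"

definition energy :: "real \<Rightarrow> real \<Rightarrow> space \<Rightarrow> real" where
  "energy \<gamma> r v = 1 / 2 * r * (norm v)\<^sup>2 + 1 / (\<gamma> * (\<gamma> - 1)) * r powr \<gamma>"

definition energy_flux :: "real \<Rightarrow> real \<Rightarrow> space \<Rightarrow> space" where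
  "energy_flux \<gamma> r v = (1 / 2 * r * (norm v)\<^sup>2 + 1 / (\<gamma> - 1) * r powr \<gamma>) *\<^sub>R v"

definition entropy_admissible ::
    "real \<Rightarrow> real \<Rightarrow> (spacetime \<Rightarrow> real) \<Rightarrow> (spacetime \<Rightarrow> space) \<Rightarrow>
     (space \<Rightarrow> real) \<Rightarrow> (space \<Rightarrow> space) \<Rightarrow> bool" where
  "entropy_admissible \<gamma> T \<rho> u \<rho>\<^sub>0 u\<^sub>0 \<longleftrightarrow>
     weak_solution \<gamma> T \<rho> u \<rho>\<^sub>0 u\<^sub>0 \<and>
     (\<forall>\<phi> :: spacetime \<Rightarrow> real. test_fun T \<phi> \<and> (\<forall>z\<in>slab T. 0 \<le> \<phi> z) \<longrightarrow>
        (LINT z|lebesgue_on (slab T).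
            energy \<gamma> (\<rho> z) (u z) * dt \<phi> z + energy_flux \<gamma> (\<rho> z) (u z) \<bullet> grad \<phi> z)
        + (LINT x|lebesgue. energy \<gamma> (\<rho>\<^sub>0 x) (u\<^sub>0 x) * \<phi> (0, x)) \<ge> 0)"

definition lebesgue_value ::
    "real \<Rightarrow> (spacetime \<Rightarrow> real) \<Rightarrow> (spacetime \<Rightarrow> space) \<Rightarrow> real \<Rightarrow>
     (space \<Rightarrow> real) \<Rightarrow> (space \<Rightarrow> space) \<Rightarrow> bool" where
  "lebesgue_value T \<rho> u \<sigma> \<rho>\<^sub>\<sigma> u\<^sub>\<sigma> \<longleftrightarrow>
     0 < \<sigma> \<and> \<sigma> < T \<and> Linf_state UNIV \<rho>\<^sub>\<sigma> u\<^sub>\<sigma> \<and>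
     (\<forall>K. compact K \<longrightarrow>
        ((\<lambda>h. 1 / (2 * h) *
            (LINT t|lebesgue_on {\<sigma> - h..\<sigma> + h}.
               LINT x|lebesgue_on K. norm ((\<rho> (t, x), u (t, x)) - (\<rho>\<^sub>\<sigma> x, u\<^sub>\<sigma> x))))
         \<longlongrightarrow> 0) (at_right 0))"

(* Near each boundary point, V is the subgraph, in some orthonormal frame with last vector e, of a
   Lipschitz function g on the plane orthogonal to e. *)
definition lipschitz_boundary :: "space set \<Rightarrow> bool" where
  "lipschitz_boundary V \<longleftrightarrow>
     (\<forall>p\<in>frontier V. \<exists>r>0. \<exists>e. norm e = 1 \<and>
        (\<exists>g L. L-lipschitz_on {y. y \<bullet> e = 0} g \<and>
           V \<inter> ball p r = {x \<in> ball p r. x \<bullet> e \<le> g (x - (x \<bullet> e) *\<^sub>R e)}))"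

definition cone_weight :: "space set \<Rightarrow> real \<Rightarrow> spacetime \<Rightarrow> real" where
  "cone_weight V \<alpha> z = max 0 (infdist (snd z) (- V) - fst z / \<alpha>)"

(* supp d_alpha intersected with the slab, where d_alpha is regarded as a function on the slab. *)
definition cone_region :: "real \<Rightarrow> space set \<Rightarrow> real \<Rightarrow> spacetime set" where
  "cone_region T V \<alpha> = closure {z \<in> slab T. cone_weight V \<alpha> z \<noteq> 0} \<inter> slab T"

definition disturbance_size ::
    "'a::euclidean_space set \<Rightarrow> ('a \<Rightarrow> real) \<Rightarrow> ('a \<Rightarrow> space) \<Rightarrow> ennreal" where
  "disturbance_size S r v = Linf_norm S (\<lambda>z. inverse (r z) * (r z - 1)) + Linf_norm S v"

definition cone_disturbance ::
    "real \<Rightarrow> (spacetime \<Rightarrow> real) \<Rightarrow> (spacetime \<Rightarrow> space) \<Rightarrow>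
     (space \<Rightarrow> real) \<Rightarrow> (space \<Rightarrow> space) \<Rightarrow> real \<Rightarrow> space set \<Rightarrow> ennreal" where
  "cone_disturbance T \<rho> u \<rho>\<^sub>0 u\<^sub>0 \<alpha> V =
     (if \<alpha> = 0 then disturbance_size V \<rho>\<^sub>0 u\<^sub>0 else disturbance_size (cone_region T V \<alpha>) \<rho> u)"

definition WS :: "real \<Rightarrow> real \<Rightarrow> bool" where
  "WS \<gamma> C \<longleftrightarrow>
     (\<forall>T \<rho> u \<rho>\<^sub>0 u\<^sub>0 m V.
        0 < T \<and> entropy_admissible \<gamma> T \<rho> u \<rho>\<^sub>0 u\<^sub>0 \<and>
        Linf_norm (slab T) (\<lambda>z. inverse (\<rho> z)) < \<infinity> \<and>
        0 < m \<and> disturbance_size (slab T) \<rho> u \<le> ennreal m \<and>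
        V \<noteq> {} \<and> closed V \<and> bounded V \<and> lipschitz_boundary V \<and>
        cone_disturbance T \<rho> u \<rho>\<^sub>0 u\<^sub>0 0 V = 0
        \<longrightarrow> Sup {\<alpha>. 0 \<le> \<alpha> \<and> \<alpha> \<le> 1 \<and> cone_disturbance T \<rho> u \<rho>\<^sub>0 u\<^sub>0 \<alpha> V = 0} \<ge> inverse (1 + C * m))"

end

theory Submission
  imports Defs
begin

text \<open>Write \<open>\<eta>\<close> for the energy density minus its linearization at the rest state
\<open>(\<rho>, u) = (1, 0)\<close>, and \<open>q\<close> for the corresponding flux. The linearization of the energy at
rest involves the density but not the momentum, so adding multiples of the mass equation and of
the conservation of a constant to the entropy inequality already gives
\<open>\<partial>\<^sub>t \<eta> + \<nabla> \<cdot> q \<le> 0\<close> in the weak sense, initial data included (\<open>rel_entropy_inequality\<close>).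
Here \<open>\<eta> \<ge> 0\<close>, with equality exactly at rest.

The constant \<open>C\<close> comes from a pointwise inequality (\<open>rel_flux_le_rel_energy\<close>): if
\<open>\<bar>(\<rho> - 1) / \<rho>\<bar> + \<bar>u\<bar> \<le> m\<close>, then \<open>\<bar>q\<bar> + m \<eta> \<le> (1 + C m) \<eta>\<close>. Near rest this expresses that the
sound speed is 1: there \<open>q\<close> is close to \<open>(\<rho> - 1) u\<close> and \<open>\<eta>\<close> is close to
\<open>((\<rho> - 1)\<^sup>2 + \<bar>u\<bar>\<^sup>2) / 2\<close>, so the arithmetic-geometric mean inequality applies and all errors are
of relative size \<open>m\<close>. Far from rest \<open>\<bar>q\<bar> \<le> C m \<eta>\<close> directly.

With \<open>c = 1 + C m\<close>, the weak inequality is tested against a nonnegative function supported in a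
backward cone of slope \<open>c\<close>: the square of the height under the surface of the cone, which decreases in
time at \<open>c\<close> times the rate at which it may vary in space. The surplus \<open>m \<eta>\<close> of the pointwise
inequality makes the dissipation strict (\<open>cone_energy_dissipation\<close>), so if the data are at rest on
the base of the cone, then \<open>\<eta> = 0\<close> inside it (\<open>rest_cone_initial\<close>). To start at a Lebesgue time
\<open>\<sigma>\<close>, the test function is multiplied by a ramp that rises from 0 to 1 on \<open>[\<sigma>, \<sigma> + h]\<close>; the
additional term is at most a multiple of the mean of \<open>\<eta>\<close> over this interval, which tends to 0 with
\<open>h\<close> since \<open>\<eta>\<close> grows at most linearly in the distance from rest on bounded states
(\<open>rest_cone_lebesgue_time\<close>).

All three parts of the theorem then follow by choosing balls. Every point of the complement of the
expanding ball is the axis point of a cone over a ball on which the data are at rest, and the region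
\<open>c t < dist(x, V\<^sup>c)\<close> of property (WS) is a union of cones over balls contained in \<open>V\<close>.\<close>

section \<open>The relative energy and its flux\<close>

text \<open>The internal energy minus its linearization at density 1.\<close>

definition rel_pot :: "real \<Rightarrow> real \<Rightarrow> real" where
  "rel_pot \<gamma> r = (r powr \<gamma> - 1 - \<gamma> * (r - 1)) / (\<gamma> * (\<gamma> - 1))"

text \<open>Taylor's theorem of third order at 1. The cubic remainder is what makes the error in the sound
speed proportional to the size of the disturbance.\<close>

lemma powr_cubic_bound:
  fixes \<gamma> :: real assumes "\<gamma> > 1"
  shows "\<exists>K>0. \<forall>r. \<bar>r - 1\<bar> < 1/2 \<longrightarrow>
    \<bar>r powr \<gamma> - 1 - \<gamma> * (r - 1) - \<gamma>*(\<gamma>-1)/2 * (r-1)\<^sup>2\<bar> \<le> K * \<bar>r - 1\<bar>^3"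
proof -
  \<comment> \<open>The n-th derivative of the power function.\<close>
  define d where "d n t = (\<Prod>k<n. \<gamma> - real k) * t powr (\<gamma> - real n)" for n t
  have d0: "d 0 = (\<lambda>r. r powr \<gamma>)" by (auto simp: d_def)
  have dd: "(d n has_real_derivative d (Suc n) t) (at t)" if "t > 0" for n t
    unfolding d_def using that
    by (auto intro!: derivative_eq_intros simp: algebra_simps)
  have "bounded (d 3 ` {1/2..3/2})"
    by (intro compact_imp_bounded compact_continuous_image) (auto simp: d_def intro!: continuous_intros)
  then obtain B where B: "B > 0" "\<And>t. t \<in> {1/2..3/2} \<Longrightarrow> \<bar>d 3 t\<bar> \<le> B"
    unfolding bounded_pos by auto
  have "\<bar>r powr \<gamma> - 1 - \<gamma> * (r - 1) - \<gamma>*(\<gamma>-1)/2 * (r-1)\<^sup>2\<bar> \<le> B * \<bar>r - 1\<bar>^3"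
    if r: "\<bar>r - 1\<bar> < 1/2" for r
  proof (cases "r = 1")
    case False
    have "\<exists>t. (if r < 1 then r < t \<and> t < 1 else 1 < t \<and> t < r) \<and>
        (\<lambda>r. r powr \<gamma>) r = (\<Sum>m<3. d m 1 / fact m * (r - 1) ^ m) + d 3 t / fact 3 * (r - 1) ^ 3"
      by (rule Taylor[where a="1/2" and b="3/2"]) (use r False dd in \<open>auto simp: d0 abs_if split: if_splits\<close>)
    then obtain t where t: "t \<in> {1/2..3/2}"
      "r powr \<gamma> = (\<Sum>m<3. d m 1 / fact m * (r - 1) ^ m) + d 3 t / fact 3 * (r - 1) ^ 3"
      using r by (cases "r < 1") (force simp: abs_if)+
    have "(\<Sum>m<3. d m 1 / fact m * (r - 1) ^ m) = 1 + \<gamma> * (r - 1) + \<gamma>*(\<gamma>-1)/2 * (r-1)\<^sup>2"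
      by (simp add: d_def numeral_3_eq_3 power2_eq_square field_simps)
    then have "r powr \<gamma> - 1 - \<gamma> * (r - 1) - \<gamma>*(\<gamma>-1)/2 * (r-1)\<^sup>2 = d 3 t / 6 * (r - 1) ^ 3"
      using t(2) by (simp add: fact_numeral)
    then have "\<bar>r powr \<gamma> - 1 - \<gamma> * (r - 1) - \<gamma>*(\<gamma>-1)/2 * (r-1)\<^sup>2\<bar> = \<bar>d 3 t / 6\<bar> * \<bar>r - 1\<bar>^3"
      by (simp only: abs_mult power_abs)
    also have "\<dots> \<le> B * \<bar>r - 1\<bar>^3"
      by (rule mult_right_mono) (use B(2)[OF t(1)] in auto)
    finally show ?thesis .
  qed auto
  with B(1) show ?thesis by blast
qed

text \<open>Near 1 the potential is \<open>(r - 1)\<^sup>2 / 2\<close> up to a cubic error; away from 1 it grows at least linearly,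
because it is convex and has its minimum at 1.\<close>

lemma rel_pot_lower_bounds:
  assumes "\<gamma> > 1"
  obtains \<delta> K where "0 < \<delta>" "\<delta> < 1/2" "K > 0"
    "\<And>r. \<bar>r - 1\<bar> \<le> \<delta> \<Longrightarrow> (r - 1)\<^sup>2 / 2 \<le> rel_pot \<gamma> r + K * \<bar>r - 1\<bar>^3"
    "\<And>r. \<bar>r - 1\<bar> \<le> \<delta> \<Longrightarrow> (r - 1)\<^sup>2 \<le> 4 * rel_pot \<gamma> r"
    "\<And>r. r > 0 \<Longrightarrow> \<bar>r - 1\<bar> \<ge> \<delta> \<Longrightarrow> \<delta> / 4 * \<bar>r - 1\<bar> \<le> rel_pot \<gamma> r"
proof -
  have g: "\<gamma> * (\<gamma> - 1) > 0" using assms by simp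
  obtain K0 where K0: "K0 > 0" and K0b: "\<And>r. \<bar>r - 1\<bar> < 1/2 \<Longrightarrow>
    \<bar>r powr \<gamma> - 1 - \<gamma> * (r - 1) - \<gamma>*(\<gamma>-1)/2 * (r-1)\<^sup>2\<bar> \<le> K0 * \<bar>r - 1\<bar>^3"
    using powr_cubic_bound[OF assms] by blast
  define K where "K = K0 / (\<gamma> * (\<gamma> - 1))"
  have K: "K > 0" using g K0 by (simp add: K_def)
  have cubic: "\<bar>rel_pot \<gamma> r - (r - 1)\<^sup>2 / 2\<bar> \<le> K * \<bar>r - 1\<bar>^3" if "\<bar>r - 1\<bar> < 1/2" for r
  proof -
    have "rel_pot \<gamma> r - (r - 1)\<^sup>2 / 2
        = (r powr \<gamma> - 1 - \<gamma> * (r - 1) - \<gamma>*(\<gamma>-1)/2 * (r-1)\<^sup>2) / (\<gamma> * (\<gamma> - 1))"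
      using assms unfolding rel_pot_def by (simp add: field_simps)
    then have "\<bar>rel_pot \<gamma> r - (r - 1)\<^sup>2 / 2\<bar>
        = \<bar>r powr \<gamma> - 1 - \<gamma> * (r - 1) - \<gamma>*(\<gamma>-1)/2 * (r-1)\<^sup>2\<bar> / (\<gamma> * (\<gamma> - 1))"
      using g by simp
    also have "\<dots> \<le> K0 * \<bar>r - 1\<bar>^3 / (\<gamma> * (\<gamma> - 1))"
      by (rule divide_right_mono[OF K0b[OF that]]) (use g in simp)
    finally show ?thesis by (simp add: K_def)
  qed
  define \<delta> where "\<delta> = min (1/4) (1 / (4 * K))"
  have \<delta>: "0 < \<delta>" "\<delta> < 1/2" "K * \<delta> \<le> 1/4"
    using K by (auto simp: \<delta>_def field_simps min_def)
  have quad: "(r - 1)\<^sup>2 \<le> 4 * rel_pot \<gamma> r" if r: "\<bar>r - 1\<bar> \<le> \<delta>" for r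
  proof -
    have "K * \<bar>r - 1\<bar>^3 = (K * \<bar>r - 1\<bar>) * (r - 1)\<^sup>2"
      by (simp add: power3_eq_cube power2_eq_square flip: abs_mult)
    also have "\<dots> \<le> 1/4 * (r - 1)\<^sup>2"
      using mult_left_mono[OF r, of K] K \<delta>(3) by (intro mult_right_mono) (linarith, simp)
    finally show ?thesis using cubic[of r] r \<delta>(2) by linarith
  qed
  have cvx: "convex_on {0<..} (rel_pot \<gamma>)"
  proof -
    have "convex_on {0<..} (\<lambda>r::real. r powr \<gamma> + (- 1 - \<gamma> * (r - 1)))"
      using assms by (intro convex_on_add powr_convex convex_onI) (auto simp: algebra_simps)
    from convex_on_cdiv[OF _ this, of "\<gamma> * (\<gamma> - 1)"] show ?thesis
      using g by (simp add: rel_pot_def[abs_def] algebra_simps)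
  qed
  have far: "\<delta> / 4 * \<bar>r - 1\<bar> \<le> rel_pot \<gamma> r" if r: "r > 0" "\<bar>r - 1\<bar> \<ge> \<delta>" for r
  proof -
    define l where "l = \<delta> / \<bar>r - 1\<bar>"
    have l: "0 < l" "l \<le> 1" "l * \<bar>r - 1\<bar> = \<delta>" using r \<delta>(1) by (auto simp: l_def)
    \<comment> \<open>The point at distance \<open>\<delta>\<close> from 1 on the segment from 1 to \<open>r\<close>, where the quadratic bound applies.\<close>
    define s where "s = (1 - l) *\<^sub>R 1 + l *\<^sub>R r"
    have "s - 1 = l * (r - 1)" by (simp add: s_def algebra_simps)
    then have s: "\<bar>s - 1\<bar> = \<delta>" using l by (simp add: abs_mult)
    have "rel_pot \<gamma> s \<le> (1 - l) * rel_pot \<gamma> 1 + l * rel_pot \<gamma> r"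
      unfolding s_def using l r by (intro convex_onD[OF cvx]) auto
    also have "rel_pot \<gamma> 1 = 0" by (simp add: rel_pot_def)
    finally have "\<delta>\<^sup>2 \<le> 4 * l * rel_pot \<gamma> r"
      using quad[of s] s power2_abs[of "s - 1"] by simp
    then have "\<delta> * (l * \<bar>r - 1\<bar>) \<le> 4 * l * rel_pot \<gamma> r"
      by (simp add: l(3) power2_eq_square)
    then have "l * (\<delta> * \<bar>r - 1\<bar>) \<le> l * (4 * rel_pot \<gamma> r)" by (simp add: algebra_simps)
    then show ?thesis using l(1) by simp
  qed
  show thesis
  proof (rule that[OF \<delta>(1,2) K _ quad far])
    show "(r - 1)\<^sup>2 / 2 \<le> rel_pot \<gamma> r + K * \<bar>r - 1\<bar>^3" if "\<bar>r - 1\<bar> \<le> \<delta>" for r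
      using cubic[of r] that \<delta>(2) by linarith
  qed
qed

lemma rel_pot_nonneg:
  assumes "\<gamma> > 1" "r > 0"
  shows "rel_pot \<gamma> r \<ge> 0"
proof -
  obtain \<delta> K where "0 < \<delta>" "\<And>r. \<bar>r - 1\<bar> \<le> \<delta> \<Longrightarrow> (r - 1)\<^sup>2 \<le> 4 * rel_pot \<gamma> r"
    "\<And>r. r > 0 \<Longrightarrow> \<bar>r - 1\<bar> \<ge> \<delta> \<Longrightarrow> \<delta> / 4 * \<bar>r - 1\<bar> \<le> rel_pot \<gamma> r"
    using rel_pot_lower_bounds[OF assms(1)] by metis
  moreover have "0 \<le> (r - 1)\<^sup>2" "0 \<le> \<delta> / 4 * \<bar>r - 1\<bar>" using \<open>0 < \<delta>\<close> by auto
  ultimately show ?thesis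
    using assms(2) by (cases "\<bar>r - 1\<bar> \<le> \<delta>") (smt (verit))+
qed

lemma rel_pot_eq_0:
  assumes "\<gamma> > 1" "r > 0" "rel_pot \<gamma> r = 0"
  shows "r = 1"
proof -
  obtain \<delta> K where \<delta>: "0 < \<delta>" "\<And>r. \<bar>r - 1\<bar> \<le> \<delta> \<Longrightarrow> (r - 1)\<^sup>2 \<le> 4 * rel_pot \<gamma> r"
    "\<And>r. r > 0 \<Longrightarrow> \<bar>r - 1\<bar> \<ge> \<delta> \<Longrightarrow> \<delta> / 4 * \<bar>r - 1\<bar> \<le> rel_pot \<gamma> r"
    using rel_pot_lower_bounds[OF assms(1)] by metis
  show ?thesis
  proof (cases "\<bar>r - 1\<bar> \<le> \<delta>")
    case True
    then show ?thesis using \<delta>(2)[of r] assms(3) by simp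
  next
    case False
    then have "\<delta> / 4 * \<bar>r - 1\<bar> \<le> 0" using \<delta>(3)[of r] assms by simp
    then show ?thesis using \<delta>(1) by (simp add: mult_le_0_iff)
  qed
qed

text \<open>The tangent to the convex function \<open>r powr \<gamma>\<close> at \<open>r\<close> lies below it at 1.\<close>

lemma rel_pot_upper:
  assumes "\<gamma> > 1" "0 < r" "r \<le> M"
  shows "rel_pot \<gamma> r \<le> (1 + M powr (\<gamma> - 1)) / (\<gamma> - 1) * \<bar>r - 1\<bar>"
proof -
  have tangent: "(1::real) \<ge> r powr \<gamma> + \<gamma> * r powr (\<gamma> - 1) * (1 - r)"
  proof -
    have "1 powr \<gamma> - r powr \<gamma> \<ge> \<gamma> * r powr (\<gamma> - 1) * (1 - r)"
      by (rule convex_on_imp_above_tangent[where A="{0<..}" and c=r, OF powr_convex])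
        (use assms in \<open>auto intro!: derivative_eq_intros simp: interior_open\<close>)
    then show ?thesis by simp
  qed
  have "r powr \<gamma> - 1 - \<gamma> * (r - 1) \<le> \<gamma> * ((r powr (\<gamma> - 1) - 1) * (r - 1))"
    using tangent by (simp add: algebra_simps)
  also have "\<dots> \<le> \<gamma> * ((1 + M powr (\<gamma> - 1)) * \<bar>r - 1\<bar>)"
  proof -
    have "\<bar>r powr (\<gamma> - 1) - 1\<bar> \<le> 1 + M powr (\<gamma> - 1)"
      using powr_mono2[of "\<gamma> - 1" r M] assms powr_ge_zero[of r "\<gamma> - 1"] by linarith
    then have "\<bar>(r powr (\<gamma> - 1) - 1) * (r - 1)\<bar> \<le> (1 + M powr (\<gamma> - 1)) * \<bar>r - 1\<bar>"
      by (simp add: abs_mult mult_right_mono)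
    then show ?thesis using assms by (intro mult_left_mono) auto
  qed
  finally have "rel_pot \<gamma> r \<le> \<gamma> * ((1 + M powr (\<gamma> - 1)) * \<bar>r - 1\<bar>) / (\<gamma> * (\<gamma> - 1))"
    using assms unfolding rel_pot_def by (intro divide_right_mono) auto
  then show ?thesis using assms by simp
qed

text \<open>The linearization of the energy at rest is \<open>\<rho> / (\<gamma> - 1) - 1 / \<gamma>\<close>, an affine function of the density
alone. The flux below is obtained by subtracting the same multiple of the mass flux.\<close>

definition rel_energy :: "real \<Rightarrow> real \<Rightarrow> space \<Rightarrow> real" where
  "rel_energy \<gamma> r v = energy \<gamma> r v - 1 / (\<gamma> - 1) * r + 1 / \<gamma>"

definition rel_flux :: "real \<Rightarrow> real \<Rightarrow> space \<Rightarrow> space" where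
  "rel_flux \<gamma> r v = energy_flux \<gamma> r v - (1 / (\<gamma> - 1) * r) *\<^sub>R v"

lemma rel_energy_eq:
  assumes "\<gamma> > 1"
  shows "rel_energy \<gamma> r v = r * (norm v)\<^sup>2 / 2 + rel_pot \<gamma> r"
  using assms unfolding rel_energy_def energy_def rel_pot_def
  by (simp add: divide_simps) (simp add: algebra_simps)

lemma rel_flux_eq:
  assumes "\<gamma> > 1"
  shows "rel_flux \<gamma> r v = (r * (norm v)\<^sup>2 / 2 + \<gamma> * rel_pot \<gamma> r + (r - 1)) *\<^sub>R v"
proof -
  have *: "1 / 2 * r * (norm v)\<^sup>2 + 1 / (\<gamma> - 1) * r powr \<gamma> - 1 / (\<gamma> - 1) * r
      = r * (norm v)\<^sup>2 / 2 + \<gamma> * rel_pot \<gamma> r + (r - 1)"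
    using assms unfolding rel_pot_def by (simp add: divide_simps) (simp add: algebra_simps)
  show ?thesis
    unfolding rel_flux_def energy_flux_def *[symmetric] by (simp add: scaleR_left_diff_distrib)
qed

lemma rel_energy_nonneg:
  assumes "\<gamma> > 1" "r > 0"
  shows "rel_energy \<gamma> r v \<ge> 0"
  using rel_pot_nonneg[OF assms] assms by (simp add: rel_energy_eq)

lemma rel_energy_eq_0:
  assumes "\<gamma> > 1" "r > 0"
  shows "rel_energy \<gamma> r v = 0 \<longleftrightarrow> r = 1 \<and> v = 0"
proof
  assume "rel_energy \<gamma> r v = 0"
  then have "r * (norm v)\<^sup>2 / 2 + rel_pot \<gamma> r = 0" by (simp add: rel_energy_eq assms)
  moreover have "r * (norm v)\<^sup>2 \<ge> 0" using assms by simp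
  ultimately have "r * (norm v)\<^sup>2 = 0" "rel_pot \<gamma> r = 0"
    using rel_pot_nonneg[OF assms] by linarith+
  then show "r = 1 \<and> v = 0" using rel_pot_eq_0[OF assms] assms by auto
qed (use assms in \<open>simp add: rel_energy_eq rel_pot_def\<close>)

text \<open>This converts \<open>L\<^sup>1\<close> convergence to the rest state, as given at a Lebesgue time, into decay of the
relative energy.\<close>

lemma rel_energy_lipschitz_at_rest:
  assumes "\<gamma> > 1" "M > 0"
  obtains L where "L > 0"
    "\<And>r v. 0 < r \<Longrightarrow> r \<le> M \<Longrightarrow> norm v \<le> M \<Longrightarrow> rel_energy \<gamma> r v \<le> L * norm (r - 1, v)"
proof
  let ?L = "M\<^sup>2 / 2 + (1 + M powr (\<gamma> - 1)) / (\<gamma> - 1)"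
  show "?L > 0" using assms by (intro add_nonneg_pos divide_pos_pos) (auto intro: add_pos_nonneg)
  fix r :: real and v :: space
  assume *: "0 < r" "r \<le> M" "norm v \<le> M"
  have "r * (norm v)\<^sup>2 / 2 \<le> M\<^sup>2 / 2 * norm v"
    using mult_mono[OF *(2) *(3)] * by (simp add: power2_eq_square mult_right_mono flip: mult.assoc)
  also have "\<dots> \<le> M\<^sup>2 / 2 * norm (r - 1, v)"
    by (intro mult_left_mono norm_snd_le) auto
  finally have 1: "r * (norm v)\<^sup>2 / 2 \<le> M\<^sup>2 / 2 * norm (r - 1, v)" .
  have "rel_pot \<gamma> r \<le> (1 + M powr (\<gamma> - 1)) / (\<gamma> - 1) * \<bar>r - 1\<bar>"
    by (rule rel_pot_upper) (use * assms in auto)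
  also have "\<dots> \<le> (1 + M powr (\<gamma> - 1)) / (\<gamma> - 1) * norm (r - 1, v)"
    using norm_fst_le[of "r - 1" v] assms by (intro mult_left_mono divide_nonneg_nonneg) (auto intro: add_nonneg_nonneg)
  finally show "rel_energy \<gamma> r v \<le> ?L * norm (r - 1, v)"
    using 1 by (simp add: rel_energy_eq assms algebra_simps)
qed

text \<open>By \<open>rel_flux_eq\<close> the flux consists of terms bounded by \<open>\<gamma> \<bar>v\<bar> \<eta>\<close> and of the cross term \<open>(r - 1) v\<close>.
For \<open>r\<close> near 1 the latter is at most \<open>r \<bar>v\<bar>\<^sup>2 / 2 + (r - 1)\<^sup>2 / (2 r)\<close>, and the second summand is the
potential up to errors of relative size \<open>m\<close>; for \<open>r\<close> away from 1 the potential dominates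
\<open>\<bar>r - 1\<bar>\<close>. The term \<open>m \<eta>\<close> on the left costs only an increase of \<open>C\<close> by 1 and later
makes the dissipation strict.\<close>

lemma rel_flux_le_rel_energy:
  assumes "\<gamma> > 1"
  obtains C where "C > 0"
    "\<And>r v m. r > 0 \<Longrightarrow> \<bar>inverse r * (r - 1)\<bar> + norm v \<le> m \<Longrightarrow>
       norm (rel_flux \<gamma> r v) + m * rel_energy \<gamma> r v \<le> (1 + C * m) * rel_energy \<gamma> r v"
proof -
  obtain \<delta> K where \<delta>: "0 < \<delta>" "\<delta> < 1/2" "K > 0"
    and cubic: "\<And>r. \<bar>r - 1\<bar> \<le> \<delta> \<Longrightarrow> (r - 1)\<^sup>2 / 2 \<le> rel_pot \<gamma> r + K * \<bar>r - 1\<bar>^3"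
    and quad: "\<And>r. \<bar>r - 1\<bar> \<le> \<delta> \<Longrightarrow> (r - 1)\<^sup>2 \<le> 4 * rel_pot \<gamma> r"
    and far: "\<And>r. r > 0 \<Longrightarrow> \<bar>r - 1\<bar> \<ge> \<delta> \<Longrightarrow> \<delta> / 4 * \<bar>r - 1\<bar> \<le> rel_pot \<gamma> r"
    using rel_pot_lower_bounds[OF assms] by metis
  \<comment> \<open>The first two summands serve densities near 1, the last one those at distance at least \<open>\<delta>\<close> from 1.\<close>
  define D where "D = 8 * K + 2 + 4 / \<delta>"
  have D: "D > 0" using \<delta> by (auto simp: D_def intro!: add_pos_pos)
  have cross: "\<bar>r - 1\<bar> * norm v \<le> rel_energy \<gamma> r v + D * m * rel_pot \<gamma> r"
    if r: "r > 0" and m: "\<bar>inverse r * (r - 1)\<bar> + norm v \<le> m" for r m and v :: space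
  proof (cases "\<bar>r - 1\<bar> \<le> \<delta>")
    case True
    have mr: "\<bar>r - 1\<bar> \<le> m * r"
      using m r by (simp add: abs_mult field_simps) (smt (verit) mult_nonneg_nonneg norm_ge_zero)
    have m0: "m \<ge> 0" using m norm_ge_zero[of v] by linarith
    \<comment> \<open>As \<open>r \<le> 2\<close>, one of the three factors in the cubic error may be traded for \<open>m\<close>.\<close>
    have y: "\<bar>r - 1\<bar> \<le> 2 * m"
      using mr mult_left_mono[of r 2 m] True \<delta>(2) m0 by linarith
    have pot: "rel_pot \<gamma> r \<ge> 0" by (rule rel_pot_nonneg[OF assms r])
    have "\<bar>r - 1\<bar> * norm v \<le> r * (norm v)\<^sup>2 / 2 + (r - 1)\<^sup>2 / r / 2"
    proof -
      define q where "q = (r - 1)\<^sup>2 / r"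
      have "0 \<le> (r * norm v - \<bar>r - 1\<bar>)\<^sup>2 / r" using r by simp
      also have "\<dots> = r * (norm v)\<^sup>2 - 2 * (\<bar>r - 1\<bar> * norm v) + q" unfolding q_def
        using r by (simp add: power2_diff power_mult_distrib field_simps) (simp add: power2_eq_square algebra_simps)
      finally show ?thesis unfolding q_def[symmetric] by simp
    qed
    also have "(r - 1)\<^sup>2 / r / 2 \<le> (r - 1)\<^sup>2 / 2 + m * (r - 1)\<^sup>2 / 2"
    proof -
      have "(r - 1)\<^sup>2 / r = (r - 1)\<^sup>2 + (- (inverse r * (r - 1))) * (r - 1)\<^sup>2"
        using r by (simp add: field_simps)
      also have "(- (inverse r * (r - 1))) * (r - 1)\<^sup>2 \<le> m * (r - 1)\<^sup>2"
        using m norm_ge_zero[of v] by (intro mult_right_mono) (linarith, simp)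
      finally show ?thesis by simp
    qed
    also have "(r - 1)\<^sup>2 / 2 \<le> rel_pot \<gamma> r + 8 * K * m * rel_pot \<gamma> r"
    proof -
      have "K * \<bar>r - 1\<bar>^3 = K * (\<bar>r - 1\<bar> * (r - 1)\<^sup>2)"
        by (simp add: power3_eq_cube power2_eq_square flip: abs_mult)
      also have "\<dots> \<le> K * ((2 * m) * (4 * rel_pot \<gamma> r))"
        using y quad[OF True] m0 \<delta>(3) by (intro mult_left_mono mult_mono) auto
      finally show ?thesis using cubic[OF True] by (simp add: algebra_simps)
    qed
    also have "m * (r - 1)\<^sup>2 / 2 \<le> 2 * m * rel_pot \<gamma> r"
      using mult_left_mono[OF quad[OF True] m0] by simp
    finally have "\<bar>r - 1\<bar> * norm v \<le> rel_energy \<gamma> r v + (8 * K + 2) * (m * rel_pot \<gamma> r)"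
      by (simp add: rel_energy_eq assms algebra_simps)
    also have "(8 * K + 2) * (m * rel_pot \<gamma> r) \<le> D * (m * rel_pot \<gamma> r)"
      using \<delta> m0 pot by (intro mult_right_mono) (auto simp: D_def)
    finally show ?thesis by (simp add: algebra_simps)
  next
    case False
    have v: "norm v \<le> m" using m by linarith
    have m0: "m \<ge> 0" using v norm_ge_zero[of v] by linarith
    have pot: "rel_pot \<gamma> r \<ge> 0" by (rule rel_pot_nonneg[OF assms r])
    have "\<bar>r - 1\<bar> \<le> 4 / \<delta> * rel_pot \<gamma> r"
      using far[OF r] False \<delta>(1) by (simp add: field_simps)
    then have "\<bar>r - 1\<bar> * norm v \<le> (4 / \<delta> * rel_pot \<gamma> r) * m"
      using v \<delta> pot by (intro mult_mono) auto
    also have "\<dots> = 4 / \<delta> * (m * rel_pot \<gamma> r)" by simp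
    also have "\<dots> \<le> D * (m * rel_pot \<gamma> r)"
      using \<delta> m0 pot by (intro mult_right_mono) (auto simp: D_def)
    also have "\<dots> \<le> rel_energy \<gamma> r v + D * m * rel_pot \<gamma> r"
      using rel_energy_nonneg[OF assms r, of v] by simp
    finally show ?thesis .
  qed
  show thesis
  proof (rule that[of "D + \<gamma> + 1"])
    show "D + \<gamma> + 1 > 0" using D assms by simp
    fix r m :: real and v :: space
    assume r: "r > 0" and m: "\<bar>inverse r * (r - 1)\<bar> + norm v \<le> m"
    let ?\<eta> = "rel_energy \<gamma> r v"
    have v: "norm v \<le> m" using m by linarith
    have m0: "m \<ge> 0" using v norm_ge_zero[of v] by linarith
    have pot: "rel_pot \<gamma> r \<ge> 0" by (rule rel_pot_nonneg[OF assms r])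
    have kin: "r * (norm v)\<^sup>2 / 2 \<ge> 0" using r by simp
    have pot_le: "rel_pot \<gamma> r \<le> ?\<eta>" using kin by (simp add: rel_energy_eq assms)
    have "norm (rel_flux \<gamma> r v) \<le> (r * (norm v)\<^sup>2 / 2 + \<gamma> * rel_pot \<gamma> r + \<bar>r - 1\<bar>) * norm v"
      using assms kin pot
      by (auto simp: rel_flux_eq intro!: mult_right_mono abs_triangle_ineq[THEN order_trans] mult_nonneg_nonneg)
    also have "\<dots> = (r * (norm v)\<^sup>2 / 2 + \<gamma> * rel_pot \<gamma> r) * norm v + \<bar>r - 1\<bar> * norm v"
      by (simp add: algebra_simps)
    also have "(r * (norm v)\<^sup>2 / 2 + \<gamma> * rel_pot \<gamma> r) * norm v \<le> (\<gamma> * ?\<eta>) * m"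
    proof (intro mult_mono v)
      have "r * (norm v)\<^sup>2 / 2 \<le> \<gamma> * (r * (norm v)\<^sup>2 / 2)"
        using assms kin by (simp add: mult_le_cancel_right1)
      then show "r * (norm v)\<^sup>2 / 2 + \<gamma> * rel_pot \<gamma> r \<le> \<gamma> * ?\<eta>"
        using assms by (simp add: rel_energy_eq distrib_left)
      show "0 \<le> \<gamma> * ?\<eta>" using rel_energy_nonneg[OF assms r, of v] assms by simp
    qed auto
    also have "\<bar>r - 1\<bar> * norm v \<le> ?\<eta> + D * m * ?\<eta>"
    proof -
      have "D * m * rel_pot \<gamma> r \<le> D * m * ?\<eta>"
        using D m0 by (intro mult_left_mono pot_le) simp
      then show ?thesis using cross[OF r m] by linarith
    qed
    finally show "norm (rel_flux \<gamma> r v) + m * ?\<eta> \<le> (1 + (D + \<gamma> + 1) * m) * ?\<eta>"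
      by (simp add: algebra_simps)
  qed
qed

section \<open>Test functions supported in cones\<close>

text \<open>A continuous cutoff in time. The ramp that starts at time -1 with length 1 equals 1 on the slab, so that
initial data and Lebesgue times are treated with the same family of test functions.\<close>

definition ramp :: "real \<Rightarrow> real \<Rightarrow> real \<Rightarrow> real" where
  "ramp a h t = min 1 (max 0 ((t - a) / h))"

definition ramp_slope :: "real \<Rightarrow> real \<Rightarrow> real \<Rightarrow> real" where
  "ramp_slope a h t = (if a < t \<and> t < a + h then 1 / h else 0)"

text \<open>The height under the surface \<open>norm (x - x\<^sub>0, d) = r - c * (t - s)\<close> of a backward cone whose tip has
been rounded: \<open>norm (x - x\<^sub>0, d)\<close> is \<open>sqrt (\<bar>x - x\<^sub>0\<bar>\<^sup>2 + d\<^sup>2)\<close>, which is smooth in \<open>x\<close> and has slope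
at most 1 for \<open>d > 0\<close>. Moreover the support ends where \<open>r - c * (t - s)\<close> reaches \<open>d\<close>, so a suitable
\<open>d\<close> keeps it away from the final time.\<close>

definition cone_height :: "space \<Rightarrow> real \<Rightarrow> real \<Rightarrow> real \<Rightarrow> real \<Rightarrow> spacetime \<Rightarrow> real" where
  "cone_height x\<^sub>0 r c d s z = max 0 (r - c * (fst z - s) - norm (snd z - x\<^sub>0, d))"

text \<open>Squaring the height makes it continuously differentiable across the surface of the cone.\<close>

definition cone_test :: "real \<Rightarrow> real \<Rightarrow> space \<Rightarrow> real \<Rightarrow> real \<Rightarrow> real \<Rightarrow> real \<Rightarrow> spacetime \<Rightarrow> real" where
  "cone_test a h x\<^sub>0 r c d s z = ramp a h (fst z) * (cone_height x\<^sub>0 r c d s z)\<^sup>2"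

definition cone_test_dt :: "real \<Rightarrow> real \<Rightarrow> space \<Rightarrow> real \<Rightarrow> real \<Rightarrow> real \<Rightarrow> real \<Rightarrow> spacetime \<Rightarrow> real" where
  "cone_test_dt a h x\<^sub>0 r c d s z = ramp_slope a h (fst z) * (cone_height x\<^sub>0 r c d s z)\<^sup>2
     - 2 * c * ramp a h (fst z) * cone_height x\<^sub>0 r c d s z"

definition cone_test_grad :: "real \<Rightarrow> real \<Rightarrow> space \<Rightarrow> real \<Rightarrow> real \<Rightarrow> real \<Rightarrow> real \<Rightarrow> spacetime \<Rightarrow> space" where
  "cone_test_grad a h x\<^sub>0 r c d s z =
    (- 2 * ramp a h (fst z) * cone_height x\<^sub>0 r c d s z / norm (snd z - x\<^sub>0, d)) *\<^sub>R (snd z - x\<^sub>0)"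

lemma ramp_bounds: "0 \<le> ramp a h t" "ramp a h t \<le> 1"
  by (auto simp: ramp_def)

lemma ramp_lipschitz: "h > 0 \<Longrightarrow> \<bar>ramp a h t - ramp a h t'\<bar> \<le> \<bar>t - t'\<bar> / h"
proof -
  assume h: "h > 0"
  have "\<bar>ramp a h t - ramp a h t'\<bar> \<le> \<bar>(t - a) / h - (t' - a) / h\<bar>"
    by (auto simp: ramp_def min_def max_def)
  also have "\<dots> = \<bar>t - t'\<bar> / h" using h by (simp flip: diff_divide_distrib)
  finally show ?thesis .
qed

lemma continuous_on_ramp [continuous_intros]:
  assumes "continuous_on A f"
  shows "continuous_on A (\<lambda>x. ramp a h (f x))"
proof (cases "h = 0")
  case False
  then show ?thesis unfolding ramp_def using assms by (auto intro!: continuous_intros)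
qed (simp add: ramp_def)

lemma ramp_has_derivative:
  assumes "h > 0" "t \<noteq> a" "t \<noteq> a + h"
  shows "(ramp a h has_real_derivative ramp_slope a h t) (at t)"
proof -
  consider "t < a" | "a < t" "t < a + h" | "a + h < t" using assms by linarith
  then show ?thesis
  proof cases
    case 1
    show ?thesis
      by (rule has_field_derivative_transform_within_open[where f="\<lambda>_. 0" and S="{..<a}"])
        (use 1 assms in \<open>auto simp: ramp_def ramp_slope_def max_def divide_less_0_iff not_le\<close>)
  next
    case 2
    have "((\<lambda>t. (t - a) / h) has_real_derivative ramp_slope a h t) (at t)"
      using 2 assms by (auto simp: ramp_slope_def intro!: derivative_eq_intros)
    then show ?thesis
      by (rule has_field_derivative_transform_within_open[where S="{a<..<a + h}"])
        (use 2 assms in \<open>auto simp: ramp_def max_def min_def field_simps\<close>)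
  next
    case 3
    show ?thesis
      by (rule has_field_derivative_transform_within_open[where f="\<lambda>_. 1" and S="{a + h<..}"])
        (use 3 assms in \<open>auto simp: ramp_def ramp_slope_def max_def min_def field_simps\<close>)
  qed
qed

lemma max_0_square_has_derivative:
  "((\<lambda>s::real. (max 0 s)\<^sup>2) has_real_derivative 2 * max 0 s) (at s)"
proof -
  consider "s < 0" | "s > 0" | "s = 0" by linarith
  then show ?thesis
  proof cases
    case 1
    show ?thesis
      by (rule has_field_derivative_transform_within_open[where f="\<lambda>_. 0" and S="{..<0}"])
        (use 1 in auto)
  next
    case 2
    show ?thesis
      by (rule has_field_derivative_transform_within_open[where f="\<lambda>s. s\<^sup>2" and S="{0<..}"])
        (use 2 in \<open>auto intro!: derivative_eq_intros\<close>)
  next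
    case 3
    have "((\<lambda>h::real. (max 0 h)\<^sup>2 / h) \<longlongrightarrow> 0) (at 0)"
    proof (rule Lim_null_comparison)
      show "\<forall>\<^sub>F h in at 0. norm ((max 0 h)\<^sup>2 / h) \<le> \<bar>h::real\<bar>"
        by (intro always_eventually allI) (auto simp: max_def power2_eq_square)
      show "((\<lambda>h::real. \<bar>h\<bar>) \<longlongrightarrow> 0) (at 0)" by (auto intro!: tendsto_eq_intros)
    qed
    then show ?thesis using 3 by (simp add: DERIV_def)
  qed
qed

lemma cone_height_nonneg [simp]: "cone_height x\<^sub>0 r c d s z \<ge> 0"
  by (simp add: cone_height_def)

lemma cone_height_sq_has_dt:
  "((\<lambda>t. (cone_height x\<^sub>0 r c d s (t, x))\<^sup>2) has_real_derivative
      - 2 * c * cone_height x\<^sub>0 r c d s (t, x)) (at t)"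
proof -
  have "((\<lambda>t. r - c * (t - s) - norm (x - x\<^sub>0, d)) has_real_derivative - c) (at t)"
    by (auto intro!: derivative_eq_intros)
  from DERIV_chain2[OF max_0_square_has_derivative this]
  show ?thesis by (simp add: cone_height_def algebra_simps)
qed

lemma cone_height_sq_has_dx:
  assumes "d > 0"
  shows "((\<lambda>\<tau>. (cone_height x\<^sub>0 r c d s (t, x + \<tau> *\<^sub>R e))\<^sup>2) has_real_derivative
      - 2 * cone_height x\<^sub>0 r c d s (t, x) * ((x - x\<^sub>0) \<bullet> e / norm (x - x\<^sub>0, d))) (at 0)"
proof -
  let ?y = "x - x\<^sub>0"
  have eq: "norm (x + \<tau> *\<^sub>R e - x\<^sub>0, d) = sqrt (?y \<bullet> ?y + 2 * \<tau> * (?y \<bullet> e) + \<tau>\<^sup>2 * (e \<bullet> e) + d\<^sup>2)" for \<tau>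
  proof -
    have "x + \<tau> *\<^sub>R e - x\<^sub>0 = ?y + \<tau> *\<^sub>R e" by simp
    then show ?thesis
      by (simp only: norm_Pair power2_norm_eq_inner)
        (simp add: inner_add_left inner_add_right inner_commute power2_eq_square algebra_simps)
  qed
  have pos: "?y \<bullet> ?y + d\<^sup>2 > 0" using assms by (intro add_nonneg_pos) auto
  have "((\<lambda>\<tau>. r - c * (t - s) - norm (x + \<tau> *\<^sub>R e - x\<^sub>0, d)) has_real_derivative
      - (?y \<bullet> e / norm (x - x\<^sub>0, d))) (at 0)"
    unfolding eq using pos
    by (auto intro!: derivative_eq_intros simp: norm_Pair power2_norm_eq_inner field_simps)
  from DERIV_chain2[OF max_0_square_has_derivative this]
  show ?thesis by (simp add: cone_height_def)
qed

lemma cone_test_has_dt: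
  assumes "h > 0" "t \<noteq> a" "t \<noteq> a + h"
  shows "((\<lambda>t. cone_test a h x\<^sub>0 r c d s (t, x)) has_vector_derivative
    cone_test_dt a h x\<^sub>0 r c d s (t, x)) (at t)"
  unfolding cone_test_def has_real_derivative_iff_has_vector_derivative[symmetric]
  by (rule DERIV_cong, simp, rule DERIV_mult[OF ramp_has_derivative[OF assms] cone_height_sq_has_dt])
    (simp add: cone_test_dt_def algebra_simps)

lemma dt_cone_test:
  assumes "h > 0" "fst z \<noteq> a" "fst z \<noteq> a + h"
  shows "dt (cone_test a h x\<^sub>0 r c d s) z = cone_test_dt a h x\<^sub>0 r c d s z"
  using vector_derivative_at[OF cone_test_has_dt[OF assms]] by (simp add: dt_def)

lemma grad_cone_test:
  assumes "d > 0"
  shows "grad (cone_test a h x\<^sub>0 r c d s) z = cone_test_grad a h x\<^sub>0 r c d s z"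
proof -
  have "dx i (cone_test a h x\<^sub>0 r c d s) z =
      - 2 * ramp a h (fst z) * cone_height x\<^sub>0 r c d s z * ((snd z - x\<^sub>0) \<bullet> axis i 1 / norm (snd z - x\<^sub>0, d))" for i
  proof -
    have "((\<lambda>\<tau>. cone_test a h x\<^sub>0 r c d s (fst z, snd z + \<tau> *\<^sub>R axis i 1)) has_real_derivative
       - 2 * ramp a h (fst z) * cone_height x\<^sub>0 r c d s z * ((snd z - x\<^sub>0) \<bullet> axis i 1 / norm (snd z - x\<^sub>0, d))) (at 0)"
      unfolding cone_test_def
      by (rule DERIV_cong, simp, rule DERIV_cmult[OF cone_height_sq_has_dx[OF assms]]) simp
    then show ?thesis
      unfolding dx_def by (simp add: has_real_derivative_iff_has_vector_derivative vector_derivative_at)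
  qed
  then show ?thesis by (simp add: grad_def cone_test_grad_def vec_eq_iff inner_axis)
qed

text \<open>Compare with the term \<open>- 2 * c * ramp * height\<close> in the time derivative: the test function decays in
time \<open>c\<close> times as fast as it can vary in space.\<close>

lemma norm_cone_test_grad:
  "norm (cone_test_grad a h x\<^sub>0 r c d s z) \<le> 2 * (ramp a h (fst z) * cone_height x\<^sub>0 r c d s z)"
proof -
  let ?N = "norm (snd z - x\<^sub>0, d)"
  have "norm (snd z - x\<^sub>0) / ?N \<le> 1"
    using norm_fst_le[of "snd z - x\<^sub>0" d] by (auto simp: divide_le_eq_1)
  then have "2 * (ramp a h (fst z) * cone_height x\<^sub>0 r c d s z) * (norm (snd z - x\<^sub>0) / ?N)
      \<le> 2 * (ramp a h (fst z) * cone_height x\<^sub>0 r c d s z)"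
    by (intro mult_left_le) (auto simp: ramp_bounds)
  then show ?thesis
    unfolding cone_test_grad_def norm_scaleR by (simp add: abs_mult ramp_bounds mult_ac)
qed

lemma cone_height_lipschitz:
  assumes "c \<ge> 0"
  shows "\<bar>cone_height x\<^sub>0 r c d s z - cone_height x\<^sub>0 r c d s w\<bar> \<le> (c + 1) * dist z w"
proof -
  have "\<bar>cone_height x\<^sub>0 r c d s z - cone_height x\<^sub>0 r c d s w\<bar>
      \<le> \<bar>c * (fst z - fst w)\<bar> + \<bar>norm (snd z - x\<^sub>0, d) - norm (snd w - x\<^sub>0, d)\<bar>"
    by (auto simp: cone_height_def max_def algebra_simps)
  also have "\<bar>c * (fst z - fst w)\<bar> \<le> c * dist z w"
    using assms dist_fst_le[of z w] by (auto simp: abs_mult dist_real_def intro!: mult_left_mono)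
  also have "\<bar>norm (snd z - x\<^sub>0, d) - norm (snd w - x\<^sub>0, d)\<bar> \<le> dist z w"
    using norm_triangle_ineq3[of "(snd z - x\<^sub>0, d)" "(snd w - x\<^sub>0, d)"] dist_snd_le[of z w]
    by (simp add: dist_norm)
  finally show ?thesis by (simp add: algebra_simps)
qed

lemma cone_height_le:
  assumes "c \<ge> 0" "fst z \<ge> 0"
  shows "cone_height x\<^sub>0 r c d s z \<le> \<bar>r + c * s\<bar>"
proof -
  have "c * fst z \<ge> 0" using assms by simp
  then have "r - c * (fst z - s) - norm (snd z - x\<^sub>0, d) \<le> \<bar>r + c * s\<bar>"
    unfolding right_diff_distrib using norm_ge_zero[of "(snd z - x\<^sub>0, d)"] by linarith
  then show ?thesis by (simp add: cone_height_def)
qed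

lemma cone_height_support:
  assumes "cone_height x\<^sub>0 r c d s z \<noteq> 0"
  shows "norm (snd z - x\<^sub>0) < r - c * (fst z - s)" "d < r - c * (fst z - s)"
proof -
  have "norm (snd z - x\<^sub>0, d) < r - c * (fst z - s)"
    using assms by (auto simp: cone_height_def max_def split: if_splits)
  then show "norm (snd z - x\<^sub>0) < r - c * (fst z - s)" "d < r - c * (fst z - s)"
    using norm_fst_le[of "snd z - x\<^sub>0" d] norm_snd_le[of d "snd z - x\<^sub>0"] by auto
qed

text \<open>The bound \<open>r - c * (t\<^sub>1 - s) \<le> d\<close> makes the height vanish from time \<open>t\<^sub>1\<close> on.\<close>

lemma cone_height_outside:
  assumes "c > 0" "r - c * (t\<^sub>1 - s) \<le> d" "fst z \<ge> 0" "z \<notin> {0..t\<^sub>1} \<times> cball x\<^sub>0 (r + c * s)"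
  shows "cone_height x\<^sub>0 r c d s z = 0"
proof (rule ccontr)
  assume "cone_height x\<^sub>0 r c d s z \<noteq> 0"
  note n = cone_height_support[OF this]
  have "c * (t\<^sub>1 - fst z) > 0" using n(2) assms(2) by (simp add: algebra_simps)
  then have "fst z \<le> t\<^sub>1" using assms(1) by (simp add: zero_less_mult_iff)
  moreover have "norm (snd z - x\<^sub>0) \<le> r + c * s"
  proof -
    have "c * fst z \<ge> 0" using assms by simp
    then show ?thesis using n(1) by (simp add: right_diff_distrib)
  qed
  ultimately show False using assms(3,4) by (cases z) (auto simp: dist_norm norm_minus_commute)
qed

lemma test_fun_cone_test:
  assumes "h > 0" "c > 0" "r - c * (t\<^sub>1 - s) \<le> d" "t\<^sub>1 < T"
  shows "test_fun T (cone_test a h x\<^sub>0 r c d s)"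
  unfolding test_fun_def
proof
  define B where "B = \<bar>r + c * s\<bar>"
  let ?H = "cone_height x\<^sub>0 r c d s"
  have "(B\<^sup>2 / h + 2 * B * (c + 1))-lipschitz_on (slab T) (cone_test a h x\<^sub>0 r c d s)"
  proof (rule lipschitz_onI)
    fix z w assume zw: "z \<in> slab T" "w \<in> slab T"
    then have b: "?H z \<le> B" "?H w \<le> B"
      using assms by (auto simp: slab_def B_def intro!: cone_height_le)
    have "cone_test a h x\<^sub>0 r c d s z - cone_test a h x\<^sub>0 r c d s w
        = (ramp a h (fst z) - ramp a h (fst w)) * (?H z)\<^sup>2
          + ramp a h (fst w) * ((?H z + ?H w) * (?H z - ?H w))"
      by (simp add: cone_test_def algebra_simps power2_eq_square)
    then have "\<bar>cone_test a h x\<^sub>0 r c d s z - cone_test a h x\<^sub>0 r c d s w\<bar>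
        \<le> \<bar>ramp a h (fst z) - ramp a h (fst w)\<bar> * (?H z)\<^sup>2
          + ramp a h (fst w) * ((?H z + ?H w) * \<bar>?H z - ?H w\<bar>)"
      using ramp_bounds[of a h "fst w"] by (simp add: abs_mult abs_triangle_ineq[THEN order_trans])
    also have "\<dots> \<le> (dist z w / h) * B\<^sup>2 + 1 * ((B + B) * ((c + 1) * dist z w))"
    proof (intro add_mono mult_mono)
      have "\<bar>fst z - fst w\<bar> / h \<le> dist z w / h"
        using dist_fst_le[of z w] assms by (simp add: dist_real_def divide_right_mono)
      then show "\<bar>ramp a h (fst z) - ramp a h (fst w)\<bar> \<le> dist z w / h"
        using ramp_lipschitz[OF assms(1), of a "fst z" "fst w"] by linarith
      show "(?H z)\<^sup>2 \<le> B\<^sup>2" using b by (intro power_mono) auto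
      show "\<bar>?H z - ?H w\<bar> \<le> (c + 1) * dist z w"
        using assms by (intro cone_height_lipschitz) auto
    qed (use b assms ramp_bounds[of a h "fst w"] in \<open>auto simp: B_def intro!: mult_nonneg_nonneg add_nonneg_nonneg\<close>)
    finally show "dist (cone_test a h x\<^sub>0 r c d s z) (cone_test a h x\<^sub>0 r c d s w)
        \<le> (B\<^sup>2 / h + 2 * B * (c + 1)) * dist z w"
      by (simp add: dist_real_def algebra_simps)
  next
    show "0 \<le> B\<^sup>2 / h + 2 * B * (c + 1)" using assms by (simp add: B_def)
  qed
  then show "\<exists>L. L-lipschitz_on (slab T) (cone_test a h x\<^sub>0 r c d s)" ..
  show "\<exists>K. compact K \<and> K \<subseteq> slab T \<and> (\<forall>z\<in>slab T - K. cone_test a h x\<^sub>0 r c d s z = 0)"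
  proof (intro exI[of _ "{0..t\<^sub>1} \<times> cball x\<^sub>0 (r + c * s)"] conjI ballI)
    fix z assume "z \<in> slab T - {0..t\<^sub>1} \<times> cball x\<^sub>0 (r + c * s)"
    then show "cone_test a h x\<^sub>0 r c d s z = 0"
      unfolding cone_test_def using assms
      by (subst cone_height_outside[where t\<^sub>1=t\<^sub>1]) (auto simp: slab_def)
  qed (use assms in \<open>auto simp: slab_def intro!: compact_Times\<close>)
qed

lemma continuous_on_cone_height: "continuous_on A (cone_height x\<^sub>0 r c d s)"
  unfolding cone_height_def by (intro continuous_intros)

lemma continuous_on_cone_test: "continuous_on A (cone_test a h x\<^sub>0 r c d s)"
  unfolding cone_test_def by (intro continuous_intros continuous_on_cone_height)

lemma borel_measurable_cone_height: "cone_height x\<^sub>0 r c d s \<in> borel_measurable borel"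
  by (intro borel_measurable_continuous_onI continuous_on_cone_height)

lemma borel_measurable_ramp: "(\<lambda>z::spacetime. ramp a h (fst z)) \<in> borel_measurable borel"
  by (intro borel_measurable_continuous_onI continuous_intros)

lemma borel_measurable_ramp_slope: "(\<lambda>z::spacetime. ramp_slope a h (fst z)) \<in> borel_measurable borel"
proof -
  have "ramp_slope a h \<in> borel_measurable borel"
    unfolding ramp_slope_def by measurable
  then show ?thesis
    by (rule measurable_compose[rotated])
      (intro borel_measurable_continuous_onI continuous_intros)
qed

lemma borel_measurable_cone_test_dt:
  "cone_test_dt a h x\<^sub>0 r c d s \<in> borel_measurable borel"
  unfolding cone_test_dt_def
  by (intro borel_measurable_diff borel_measurable_times borel_measurable_power borel_measurable_const
      borel_measurable_ramp borel_measurable_ramp_slope borel_measurable_cone_height)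

lemma borel_measurable_cone_test_grad:
  "d > 0 \<Longrightarrow> cone_test_grad a h x\<^sub>0 r c d s \<in> borel_measurable borel"
  unfolding cone_test_grad_def
  by (intro borel_measurable_continuous_onI continuous_intros continuous_on_cone_height) (auto simp: norm_Pair)

lemma AE_fst_neq: "AE z::spacetime in lebesgue. fst z \<noteq> a"
proof -
  have "negligible {z::spacetime. z \<bullet> (1, 0) = a}"
    by (rule negligible_standard_hyperplane) (simp add: Basis_prod_def)
  then have "{z::spacetime. fst z = a} \<in> null_sets lebesgue"
    by (simp add: negligible_iff_null_sets inner_prod_def)
  from AE_not_in[OF this] show ?thesis by simp
qed

section \<open>Integration over space and time\<close>

lemma slab_measurable [measurable]: "slab T \<in> sets lebesgue" "slab T \<in> sets borel"
proof -
  show "slab T \<in> sets borel"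
    unfolding slab_def by (intro borel_Times) auto
  then show "slab T \<in> sets lebesgue" by simp
qed

lemma cone_test_dt_bound:
  assumes "h > 0" "c > 0" "fst z \<ge> 0"
  shows "\<bar>cone_test_dt a h x\<^sub>0 r c d s z\<bar> \<le> \<bar>r + c * s\<bar>\<^sup>2 / h + 2 * c * \<bar>r + c * s\<bar>"
proof -
  let ?H = "cone_height x\<^sub>0 r c d s z" and ?B = "\<bar>r + c * s\<bar>"
  have H: "0 \<le> ?H" "?H \<le> ?B" using assms by (auto intro: cone_height_le)
  have "\<bar>cone_test_dt a h x\<^sub>0 r c d s z\<bar> \<le> ramp_slope a h (fst z) * ?H\<^sup>2 + 2 * c * ramp a h (fst z) * ?H"
    unfolding cone_test_dt_def using assms H ramp_bounds[of a h "fst z"]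
    by (intro abs_triangle_ineq4[THEN order_trans]) (simp add: abs_mult ramp_slope_def)
  also have "\<dots> \<le> 1 / h * ?B\<^sup>2 + 2 * c * 1 * ?B"
    using assms H ramp_bounds[of a h "fst z"]
    by (intro add_mono mult_mono power_mono) (auto simp: ramp_slope_def)
  finally show ?thesis by simp
qed

lemma cone_test_dt_outside:
  assumes "c > 0" "r - c * (t\<^sub>1 - s) \<le> d" "fst z \<ge> 0" "z \<notin> {0..t\<^sub>1} \<times> cball x\<^sub>0 (r + c * s)"
  shows "cone_test_dt a h x\<^sub>0 r c d s z = 0"
  by (simp add: cone_test_dt_def cone_height_outside[OF assms])

lemma integrable_cone_test_dt:
  assumes "h > 0" "c > 0" "r - c * (t\<^sub>1 - s) \<le> d"
  shows "integrable lborel (\<lambda>z. indicator (slab T) z *\<^sub>R cone_test_dt a h x\<^sub>0 r c d s z)"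
proof (rule integrableI_bounded_set[where A="{0..t\<^sub>1} \<times> cball x\<^sub>0 (r + c * s)"
      and B="\<bar>r + c * s\<bar>\<^sup>2 / h + 2 * c * \<bar>r + c * s\<bar>"])
  have "compact ({0..t\<^sub>1} \<times> cball x\<^sub>0 (r + c * s))" by (intro compact_Times) auto
  then show "{0..t\<^sub>1} \<times> cball x\<^sub>0 (r + c * s) \<in> sets lborel"
    "emeasure lborel ({0..t\<^sub>1} \<times> cball x\<^sub>0 (r + c * s)) < \<infinity>"
    using emeasure_bounded_finite[OF compact_imp_bounded] by (auto intro: borel_closed compact_imp_closed)
  show "(\<lambda>z. indicator (slab T) z *\<^sub>R cone_test_dt a h x\<^sub>0 r c d s z) \<in> borel_measurable lborel"
    using borel_measurable_cone_test_dt slab_measurable(2)[of T] by simp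
  show "AE z in lborel. z \<in> {0..t\<^sub>1} \<times> cball x\<^sub>0 (r + c * s) \<longrightarrow>
      norm (indicator (slab T) z *\<^sub>R cone_test_dt a h x\<^sub>0 r c d s z) \<le> \<bar>r + c * s\<bar>\<^sup>2 / h + 2 * c * \<bar>r + c * s\<bar>"
  proof (intro AE_I2 impI)
    fix z
    show "norm (indicator (slab T) z *\<^sub>R cone_test_dt a h x\<^sub>0 r c d s z) \<le> \<bar>r + c * s\<bar>\<^sup>2 / h + 2 * c * \<bar>r + c * s\<bar>"
    proof (cases "z \<in> slab T")
      case True
      then show ?thesis using cone_test_dt_bound[OF assms(1,2), of z] by (auto simp: slab_def)
    qed (use assms in \<open>auto intro!: add_nonneg_nonneg mult_nonneg_nonneg divide_nonneg_nonneg\<close>)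
  qed
  show "AE z in lborel. z \<notin> {0..t\<^sub>1} \<times> cball x\<^sub>0 (r + c * s) \<longrightarrow>
      indicator (slab T) z *\<^sub>R cone_test_dt a h x\<^sub>0 r c d s z = 0"
    by (intro AE_I2 impI)
      (auto simp: slab_def indicator_def intro!: cone_test_dt_outside[OF assms(2,3)])
qed

text \<open>The weak form of the conservation of a constant: the fundamental theorem of calculus on each line
parallel to the time axis, and Fubini's theorem. It accounts for the constant term of the relative
energy.\<close>

lemma integral_cone_test_dt:
  assumes "h > 0" "c > 0" "r - c * (t\<^sub>1 - s) \<le> d" "t\<^sub>1 < T" "0 < T"
  shows "(LINT z|lebesgue_on (slab T). cone_test_dt a h x\<^sub>0 r c d s z)
    + (LINT x|lebesgue. cone_test a h x\<^sub>0 r c d s (0, x)) = 0"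
proof -
  let ?f = "cone_test a h x\<^sub>0 r c d s" and ?g = "cone_test_dt a h x\<^sub>0 r c d s"
  note int = integrable_cone_test_dt[OF assms(1-3), of T a x\<^sub>0]
  have inner: "(LINT t|lborel. indicator (slab T) (t, x) *\<^sub>R ?g (t, x)) = - ?f (0, x)" 
    if i: "integrable lborel (\<lambda>t. indicator (slab T) (t, x) *\<^sub>R ?g (t, x))" for x
  proof -
    have eq: "indicator (slab T) (t, x) *\<^sub>R ?g (t, x) = indicator {0..<T} t *\<^sub>R ?g (t, x)" for t
      by (simp add: slab_def indicator_def)
    have si: "set_integrable lborel {0..<T} (\<lambda>t. ?g (t, x))"
      using i unfolding eq set_integrable_def .
    have "((\<lambda>t. ?g (t, x)) has_integral ?f (T, x) - ?f (0, x)) {0..T}"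
    proof (rule fundamental_theorem_of_calculus_strong[where S="{a, a + h}"])
      fix t assume "t \<in> {0..T} - {a, a + h}"
      then have t: "t \<noteq> a" "t \<noteq> a + h" by auto
      show "((\<lambda>t. ?f (t, x)) has_vector_derivative ?g (t, x)) (at t)"
        by (rule cone_test_has_dt[OF assms(1) t])
    next
      show "continuous_on {0..T} (\<lambda>t. ?f (t, x))"
        by (intro continuous_on_compose2[OF continuous_on_cone_test] continuous_intros) auto
    qed (use assms in auto)
    moreover have "?f (T, x) = 0"
      unfolding cone_test_def
      by (subst cone_height_outside[where t\<^sub>1=t\<^sub>1]) (use assms in auto)
    ultimately have "((\<lambda>t. ?g (t, x)) has_integral - ?f (0, x)) {0..T}" by simp
    then have "((\<lambda>t. ?g (t, x)) has_integral - ?f (0, x)) {0..<T}"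
      by (subst has_integral_spike_set_eq[of _ "{0..T}"]) (auto intro: negligible_subset[of "{T}"])
    then show ?thesis
      unfolding eq using set_borel_integral_eq_integral(2)[OF si]
      by (simp add: set_lebesgue_integral_def integral_unique)
  qed
  have prod: "(lborel :: spacetime measure) = lborel \<Otimes>\<^sub>M lborel" by (simp add: lborel_prod)
  have intp: "integrable (lborel \<Otimes>\<^sub>M lborel) (\<lambda>(t, x). indicator (slab T) (t, x) *\<^sub>R ?g (t, x))"
    using int by (simp add: lborel_prod case_prod_unfold)
  have "(LINT z|lebesgue_on (slab T). ?g z) = (LINT z|lebesgue. indicator (slab T) z *\<^sub>R ?g z)"
    by (rule integral_restrict_space) simp
  also have "\<dots> = (LINT z|lborel. indicator (slab T) z *\<^sub>R ?g z)"
    by (rule integral_completion) (use int in \<open>rule borel_measurable_integrable\<close>)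
  also have "\<dots> = (LINT x|lborel. LINT t|lborel. indicator (slab T) (t, x) *\<^sub>R ?g (t, x))"
    using lborel_pair.integral_snd[OF intp] by (simp add: lborel_prod case_prod_unfold)
  also have "\<dots> = (LINT x|lborel. - ?f (0, x))"
  proof (rule integral_cong_AE)
    show "AE x in lborel. (LINT t|lborel. indicator (slab T) (t, x) *\<^sub>R ?g (t, x)) = - ?f (0, x)"
      using lborel_pair.AE_integrable_snd[OF intp] by eventually_elim (rule inner)
    show "(\<lambda>x. LINT t|lborel. indicator (slab T) (t, x) *\<^sub>R ?g (t, x)) \<in> borel_measurable lborel"
      using lborel_pair.integrable_snd[OF intp] by (rule borel_measurable_integrable)
    show "(\<lambda>x. - ?f (0, x)) \<in> borel_measurable lborel"
      by (simp, intro borel_measurable_continuous_onI continuous_intros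
          continuous_on_compose2[OF continuous_on_cone_test]) auto
  qed
  also have "\<dots> = - (LINT x|lebesgue. ?f (0, x))"
  proof -
    have "(\<lambda>x. ?f (0, x)) \<in> borel_measurable lborel"
      by (simp, intro borel_measurable_continuous_onI continuous_intros
          continuous_on_compose2[OF continuous_on_cone_test]) auto
    then show ?thesis by (simp add: integral_completion)
  qed
  finally show ?thesis by simp
qed

text \<open>Since the measure is complete, either both functions are measurable or
neither is, and in the latter case both integrals are 0.\<close>

lemma integral_lebesgue_cong_AE:
  fixes f g :: "'a::euclidean_space \<Rightarrow> real"
  assumes "AE x in lebesgue. f x = g x"
  shows "integral\<^sup>L lebesgue f = integral\<^sup>L lebesgue g"
proof (cases "f \<in> borel_measurable lebesgue")
  case True
  then show ?thesis by (rule integral_cong_AE[OF _ borel_measurable_AE[OF True assms] assms])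
next
  case False
  have "AE x in lebesgue. g x = f x" using assms by eventually_elim simp
  then have "g \<notin> borel_measurable lebesgue" using False borel_measurable_AE by blast
  then have "\<not> integrable lebesgue f" "\<not> integrable lebesgue g"
    using False borel_measurable_integrable by blast+
  then show ?thesis by (simp add: not_integrable_integral_eq)
qed

text \<open>Fubini's theorem for functions that are measurable only for the completed measure on the product. Their
sections need not be measurable, but almost all of them agree almost everywhere with the sections
of a Borel function.\<close>

lemma integral_lebesgue_fst:
  fixes f :: "'a::euclidean_space \<times> 'b::euclidean_space \<Rightarrow> real"
  assumes f: "integrable lebesgue f"
  shows "integral\<^sup>L lebesgue f = (LINT t|lebesgue. LINT x|lebesgue. f (t, x))"
proof -
  obtain g where g: "g \<in> borel_measurable lborel" "AE z in lborel. f z = g z"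
    using completion_ex_borel_measurable_real[of f lborel] f by auto
  have gl: "g \<in> borel_measurable lebesgue" using g(1) by (rule measurable_completion)
  have ae: "AE z in lebesgue. f z = g z" using g(2) by (rule AE_completion)
  have "integrable lebesgue g"
    using f integrable_cong_AE[OF borel_measurable_integrable[OF f] gl ae] by simp
  then have gi: "integrable (lborel \<Otimes>\<^sub>M lborel) g"
    using g(1) by (simp add: integrable_completion lborel_prod)
  have sect: "AE t in lborel. AE x in lborel. g (t, x) = f (t, x)"
  proof (rule lborel_pair.AE_pair)
    show "AE z in lborel \<Otimes>\<^sub>M lborel. g z = f z"
      unfolding lborel_prod using g(2) by eventually_elim simp
  qed
  have inner: "AE t in lborel. (LINT x|lborel. g (t, x)) = (LINT x|lebesgue. f (t, x))"
    using sect lborel_pair.AE_integrable_fst'[OF gi]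
  proof eventually_elim
    fix t assume t: "AE x in lborel. g (t, x) = f (t, x)" and i: "integrable lborel (\<lambda>x. g (t, x))"
    have m: "(\<lambda>x. g (t, x)) \<in> borel_measurable lborel" using i by auto
    have a: "AE x in lebesgue. g (t, x) = f (t, x)" using t by (rule AE_completion)
    have "(LINT x|lborel. g (t, x)) = (LINT x|lebesgue. g (t, x))"
      using m by (simp add: integral_completion)
    also have "\<dots> = (LINT x|lebesgue. f (t, x))"
      by (rule integral_lebesgue_cong_AE[OF a])
    finally show "(LINT x|lborel. g (t, x)) = (LINT x|lebesgue. f (t, x))" .
  qed
  have om: "(\<lambda>t. LINT x|lborel. g (t, x)) \<in> borel_measurable lborel"
    using lborel_pair.integrable_fst'[OF gi] by (rule borel_measurable_integrable)
  have inner': "AE t in lebesgue. (LINT x|lborel. g (t, x)) = (LINT x|lebesgue. f (t, x))"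
    using inner by (rule AE_completion)
  have "integral\<^sup>L lebesgue f = integral\<^sup>L lebesgue g"
    by (rule integral_lebesgue_cong_AE[OF ae])
  also have "\<dots> = integral\<^sup>L lborel g" using g(1) by (simp add: integral_completion)
  also have "\<dots> = (LINT t|lborel. LINT x|lborel. g (t, x))"
    using lborel_pair.integral_fst'[OF gi] by (simp add: lborel_prod)
  also have "\<dots> = (LINT t|lebesgue. LINT x|lborel. g (t, x))"
    using om by (simp add: integral_completion)
  also have "\<dots> = (LINT t|lebesgue. LINT x|lebesgue. f (t, x))"
    by (rule integral_lebesgue_cong_AE[OF inner'])
  finally show ?thesis .
qed

section \<open>The relative entropy inequality\<close>

lemma Linf_norm_AE_bound:
  assumes "Linf_norm S f < \<infinity>"
  obtains B where "B > 0" "AE z in lebesgue_on S. norm (f z) \<le> B"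
proof
  let ?B = "enn2real (Linf_norm S f) + 1"
  show "?B > 0" by (simp add: add_nonneg_pos)
  have "AE z in lebesgue_on S. ennreal (norm (f z)) \<le> Linf_norm S f"
    unfolding Linf_norm_def by (rule esssup_AE)
  then show "AE z in lebesgue_on S. norm (f z) \<le> ?B"
  proof eventually_elim
    fix z assume "ennreal (norm (f z)) \<le> Linf_norm S f"
    then have "norm (f z) \<le> enn2real (Linf_norm S f)"
      using assms by (metis enn2real_ennreal enn2real_mono infinity_ennreal_def norm_ge_zero)
    then show "norm (f z) \<le> ?B" by simp
  qed
qed

lemma Linf_state_AE_bound:
  assumes "Linf_state S r v"
  obtains M where "M > 0" "AE z in lebesgue_on S. 0 < r z \<and> r z \<le> M \<and> norm (v z) \<le> M"
proof -
  obtain A B where "A > 0" and A: "AE z in lebesgue_on S. norm (r z) \<le> A"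
    and "B > 0" and B: "AE z in lebesgue_on S. norm (v z) \<le> B"
    using assms Linf_norm_AE_bound unfolding Linf_state_def by metis
  have "AE z in lebesgue_on S. r z > 0" using assms by (simp add: Linf_state_def)
  with A B have "AE z in lebesgue_on S. 0 < r z \<and> r z \<le> max A B \<and> norm (v z) \<le> max A B"
    by eventually_elim auto
  then show thesis using \<open>A > 0\<close> by (intro that[of "max A B"]) auto
qed

lemma integrable_mult_AE_bounded:
  fixes f :: "'a \<Rightarrow> real"
  assumes "integrable M f" "k \<in> borel_measurable M" "AE z in M. \<bar>k z\<bar> \<le> B"
  shows "integrable M (\<lambda>z. k z * f z)"
proof (rule Bochner_Integration.integrable_bound)
  show "integrable M (\<lambda>z. B * f z)" using assms(1) by simp
  show "(\<lambda>z. k z * f z) \<in> borel_measurable M"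
    using assms(2) borel_measurable_integrable[OF assms(1)] by measurable
  show "AE z in M. norm (k z * f z) \<le> norm (B * f z)"
    using assms(3) by eventually_elim (auto simp: abs_mult intro!: mult_right_mono)
qed

lemma integrable_inner_AE_bounded:
  fixes f k :: "'a \<Rightarrow> 'b::euclidean_space"
  assumes "integrable M f" "k \<in> borel_measurable M" "AE z in M. norm (k z) \<le> B"
  shows "integrable M (\<lambda>z. k z \<bullet> f z)"
proof (rule Bochner_Integration.integrable_bound)
  show "integrable M (\<lambda>z. B *\<^sub>R f z)" using assms(1) by simp
  show "(\<lambda>z. k z \<bullet> f z) \<in> borel_measurable M"
    using assms(2) borel_measurable_integrable[OF assms(1)] by measurable
  show "AE z in M. norm (k z \<bullet> f z) \<le> norm (B *\<^sub>R f z)"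
    using assms(3)
  proof eventually_elim
    fix z assume "norm (k z) \<le> B"
    then have "norm (k z) * norm (f z) \<le> \<bar>B\<bar> * norm (f z)" by (intro mult_right_mono) auto
    then show "norm (k z \<bullet> f z) \<le> norm (B *\<^sub>R f z)"
      using Cauchy_Schwarz_ineq2[of "k z" "f z"] by simp
  qed
qed

lemma borel_measurable_slab:
  "f \<in> borel_measurable borel \<Longrightarrow> f \<in> borel_measurable (lebesgue_on (slab T))"
  by (intro measurable_restrict_space1 measurable_completion) simp

lemma integrable_slab_bounded:
  fixes f :: "spacetime \<Rightarrow> 'b::{banach, second_countable_topology}"
  assumes "f \<in> borel_measurable borel" "compact K"
    and "\<And>z. z \<in> slab T \<Longrightarrow> norm (f z) \<le> B" "\<And>z. z \<in> slab T \<Longrightarrow> z \<notin> K \<Longrightarrow> f z = 0"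
  shows "integrable (lebesgue_on (slab T)) f"
proof (rule integrableI_bounded_set[where A="K \<inter> slab T" and B=B])
  have K: "K \<in> sets lebesgue" "emeasure lebesgue K < \<infinity>"
    using emeasure_bounded_finite[OF compact_imp_bounded[OF assms(2)]] borel_closed[OF compact_imp_closed[OF assms(2)]]
    by auto
  show "K \<inter> slab T \<in> sets (lebesgue_on (slab T))"
    using K by (subst sets_restrict_space_iff) auto
  have "emeasure (lebesgue_on (slab T)) (K \<inter> slab T) = emeasure lebesgue (K \<inter> slab T)"
    by (rule emeasure_restrict_space) auto
  also have "\<dots> \<le> emeasure lebesgue K" using K by (intro emeasure_mono) auto
  finally show "emeasure (lebesgue_on (slab T)) (K \<inter> slab T) < \<infinity>" using K(2) by (auto intro: le_less_trans)
  show "f \<in> borel_measurable (lebesgue_on (slab T))" by (rule borel_measurable_slab[OF assms(1)])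
qed (use assms in \<open>auto simp: space_restrict_space\<close>)

text \<open>The parameters of a test function whose support ends before the final time.\<close>

context
  fixes a h :: real and x\<^sub>0 :: space and r c d s t\<^sub>1 T :: real
  assumes hyp: "h > 0" "c > 0" "d > 0" "r - c * (t\<^sub>1 - s) \<le> d" "t\<^sub>1 < T" "0 < T"
begin

private abbreviation "\<phi> \<equiv> cone_test a h x\<^sub>0 r c d s"
private abbreviation "D \<equiv> cone_test_dt a h x\<^sub>0 r c d s"
private abbreviation "G \<equiv> cone_test_grad a h x\<^sub>0 r c d s"
private abbreviation "H \<equiv> cone_height x\<^sub>0 r c d s"
private abbreviation "\<theta> \<equiv> (\<lambda>z::spacetime. ramp a h (fst z))"
private abbreviation "\<theta>' \<equiv> (\<lambda>z::spacetime. ramp_slope a h (fst z))"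
private abbreviation "K \<equiv> {0..t\<^sub>1} \<times> cball x\<^sub>0 (r + c * s)"
private abbreviation "M \<equiv> lebesgue_on (slab T)"

private lemma compact_K: "compact K" by (intro compact_Times) auto

private lemma outside: "z \<in> slab T \<Longrightarrow> z \<notin> K \<Longrightarrow> H z = 0"
  by (rule cone_height_outside[OF hyp(2,4)]) (auto simp: slab_def)

private lemma height_le: "z \<in> slab T \<Longrightarrow> H z \<le> \<bar>r + c * s\<bar>"
  using hyp by (intro cone_height_le) (auto simp: slab_def)

lemma integrable_ramp_height: "integrable M (\<lambda>z. \<theta> z * H z)"
proof (rule integrable_slab_bounded[OF _ compact_K])
  fix z assume "z \<in> slab T"
  then have "\<theta> z * H z \<le> 1 * \<bar>r + c * s\<bar>" by (intro mult_mono height_le) (auto simp: ramp_bounds)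
  then show "norm (\<theta> z * H z) \<le> \<bar>r + c * s\<bar>" by (simp add: abs_mult ramp_bounds)
qed (auto simp: outside intro!: borel_measurable_times borel_measurable_ramp borel_measurable_cone_height)

lemma integrable_slope_height: "integrable M (\<lambda>z. \<theta>' z * (H z)\<^sup>2)"
proof (rule integrable_slab_bounded[OF _ compact_K])
  fix z assume "z \<in> slab T"
  then have "\<theta>' z * (H z)\<^sup>2 \<le> 1 / h * \<bar>r + c * s\<bar>\<^sup>2"
    using hyp by (intro mult_mono power_mono height_le) (auto simp: ramp_slope_def)
  then show "norm (\<theta>' z * (H z)\<^sup>2) \<le> 1 / h * \<bar>r + c * s\<bar>\<^sup>2" using hyp by (simp add: abs_mult ramp_slope_def)
qed (auto simp: outside intro!: borel_measurable_times borel_measurable_power borel_measurable_ramp_slope borel_measurable_cone_height)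

lemma integrable_dt: "integrable M D"
proof (rule integrable_slab_bounded[OF borel_measurable_cone_test_dt compact_K])
  show "norm (D z) \<le> \<bar>r + c * s\<bar>\<^sup>2 / h + 2 * c * \<bar>r + c * s\<bar>" if "z \<in> slab T" for z
    using cone_test_dt_bound[OF hyp(1,2), of z a x\<^sub>0 r d s] that by (auto simp: slab_def)
  show "D z = 0" if "z \<in> slab T" "z \<notin> K" for z
    by (rule cone_test_dt_outside[OF hyp(2,4) _ that(2)]) (use that(1) in \<open>auto simp: slab_def\<close>)
qed

lemma integrable_grad: "integrable M G"
proof (rule integrable_slab_bounded[OF borel_measurable_cone_test_grad[OF hyp(3)] compact_K])
  fix z assume "z \<in> slab T"
  then have "\<theta> z * H z \<le> 1 * \<bar>r + c * s\<bar>" by (intro mult_mono height_le) (auto simp: ramp_bounds)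
  then show "norm (G z) \<le> 2 * \<bar>r + c * s\<bar>" using norm_cone_test_grad[of a h x\<^sub>0 r c d s z] by linarith
qed (auto simp: cone_test_grad_def outside)

lemma integrable_initial: "integrable lebesgue (\<lambda>x. \<phi> (0, x))"
proof -
  have m: "(\<lambda>x. \<phi> (0, x)) \<in> borel_measurable borel"
    by (intro borel_measurable_continuous_onI continuous_intros
          continuous_on_compose2[OF continuous_on_cone_test]) auto
  have "integrable lborel (\<lambda>x. \<phi> (0, x))"
  proof (rule integrableI_bounded_set[where A="cball x\<^sub>0 (r + c * s)" and B="\<bar>r + c * s\<bar>\<^sup>2"])
    show "emeasure lborel (cball x\<^sub>0 (r + c * s)) < \<infinity>"
      using emeasure_bounded_finite[OF bounded_cball] by simp
    have "norm (\<phi> (0, x)) \<le> \<bar>r + c * s\<bar>\<^sup>2" for x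
    proof -
      have "\<theta> (0, x) * (H (0, x))\<^sup>2 \<le> 1 * \<bar>r + c * s\<bar>\<^sup>2"
        using hyp by (intro mult_mono power_mono height_le) (auto simp: ramp_bounds slab_def)
      then show ?thesis by (simp add: cone_test_def abs_mult ramp_bounds)
    qed
    then show "AE x in lborel. x \<in> cball x\<^sub>0 (r + c * s) \<longrightarrow> norm (\<phi> (0, x)) \<le> \<bar>r + c * s\<bar>\<^sup>2"
      by simp
    show "AE x in lborel. x \<notin> cball x\<^sub>0 (r + c * s) \<longrightarrow> \<phi> (0, x) = 0"
    proof (intro AE_I2 impI)
      fix x assume "x \<notin> cball x\<^sub>0 (r + c * s)"
      then have "H (0, x) = 0" using hyp by (intro outside) (auto simp: slab_def)
      then show "\<phi> (0, x) = 0" by (simp add: cone_test_def)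
    qed
  qed (use m in auto)
  then show ?thesis using m by (simp add: integrable_completion)
qed

text \<open>The entropy inequality, minus \<open>1 / (\<gamma> - 1)\<close> times the mass equation, plus \<open>1 / \<gamma>\<close> times the
conservation of 1. Boundedness of the state makes every term integrable, as needed to
split the integrals.\<close>

lemma rel_entropy_inequality:
  assumes g: "\<gamma> > 1" and ent: "entropy_admissible \<gamma> T \<rho> u \<rho>\<^sub>0 u\<^sub>0"
  shows "0 \<le> (LINT z|M. rel_energy \<gamma> (\<rho> z) (u z) * D z + rel_flux \<gamma> (\<rho> z) (u z) \<bullet> G z)
    + (LINT x|lebesgue. rel_energy \<gamma> (\<rho>\<^sub>0 x) (u\<^sub>0 x) * \<phi> (0, x))"
proof -
  have ws: "weak_solution \<gamma> T \<rho> u \<rho>\<^sub>0 u\<^sub>0" using ent by (simp add: entropy_admissible_def)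
  then have st: "Linf_state (slab T) \<rho> u" and st0: "Linf_state UNIV \<rho>\<^sub>0 u\<^sub>0"
    by (auto simp: weak_solution_def)
  have tf: "test_fun T \<phi>" by (rule test_fun_cone_test[OF hyp(1,2,4,5)])
  have nonneg: "\<forall>z\<in>slab T. 0 \<le> \<phi> z" by (simp add: cone_test_def ramp_bounds)
  have gr: "grad \<phi> = G" using grad_cone_test[OF hyp(3)] by (simp add: fun_eq_iff)
  have dtae: "AE z in lebesgue. D z = dt \<phi> z"
    using AE_fst_neq[of a] AE_fst_neq[of "a + h"]
    by eventually_elim (use dt_cone_test[OF hyp(1)] in auto)
  have Dm: "D \<in> borel_measurable lebesgue"
    using borel_measurable_cone_test_dt by (intro measurable_completion) simp
  have dtm: "dt \<phi> \<in> borel_measurable M"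
    using borel_measurable_AE[OF Dm dtae] by (rule measurable_restrict_space1)
  have Dm': "D \<in> borel_measurable M" using Dm by (rule measurable_restrict_space1)
  have Gm: "G \<in> borel_measurable M"
    by (rule borel_measurable_slab[OF borel_measurable_cone_test_grad[OF hyp(3)]])
  have dtae': "AE z in M. D z = dt \<phi> z"
    using eventually_mono[OF dtae] by (simp add: AE_restrict_space_iff)
  have m [measurable]: "\<rho> \<in> borel_measurable M" "u \<in> borel_measurable M"
    "\<rho>\<^sub>0 \<in> borel_measurable lebesgue" "u\<^sub>0 \<in> borel_measurable lebesgue"
    using st st0 by (auto simp: Linf_state_def lebesgue_on_UNIV_eq)
  note [measurable] = dtm Dm' Gm
  obtain B where B: "B > 0" "AE z in M. 0 < \<rho> z \<and> \<rho> z \<le> B \<and> norm (u z) \<le> B"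
    using Linf_state_AE_bound[OF st] by blast
  obtain B0 where B0: "B0 > 0" "AE z in lebesgue. 0 < \<rho>\<^sub>0 z \<and> \<rho>\<^sub>0 z \<le> B0 \<and> norm (u\<^sub>0 z) \<le> B0"
    using Linf_state_AE_bound[OF st0, unfolded lebesgue_on_UNIV_eq] by blast
  have Em [measurable]: "(\<lambda>z. energy \<gamma> (\<rho> z) (u z)) \<in> borel_measurable M"
    "(\<lambda>z. energy_flux \<gamma> (\<rho> z) (u z)) \<in> borel_measurable M"
    "(\<lambda>x. energy \<gamma> (\<rho>\<^sub>0 x) (u\<^sub>0 x)) \<in> borel_measurable lebesgue"
    unfolding energy_def energy_flux_def by measurable
  have Eb: "\<bar>energy \<gamma> q v\<bar> \<le> 1 / 2 * b * b\<^sup>2 + 1 / (\<gamma> * (\<gamma> - 1)) * b powr \<gamma>"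
    and Fb: "norm (energy_flux \<gamma> q v) \<le> (1 / 2 * b * b\<^sup>2 + 1 / (\<gamma> - 1) * b powr \<gamma>) * b"
    if "0 < q \<and> q \<le> b \<and> norm v \<le> b" for q b v
  proof -
    have 1: "1 / 2 * q * (norm v)\<^sup>2 \<le> 1 / 2 * b * b\<^sup>2" "q powr \<gamma> \<le> b powr \<gamma>"
      using that g by (auto intro!: mult_mono power_mono powr_mono2)
    have 2: "1 / 2 * q * (norm v)\<^sup>2 \<ge> 0" using that by simp
    have 3: "1 / (\<gamma> * (\<gamma> - 1)) * q powr \<gamma> \<le> 1 / (\<gamma> * (\<gamma> - 1)) * b powr \<gamma>"
      "1 / (\<gamma> - 1) * q powr \<gamma> \<le> 1 / (\<gamma> - 1) * b powr \<gamma>"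
      using 1(2) g by (auto intro!: mult_left_mono divide_right_mono)
    have 4: "1 / (\<gamma> * (\<gamma> - 1)) * q powr \<gamma> \<ge> 0" "1 / (\<gamma> - 1) * q powr \<gamma> \<ge> 0" using g by auto
    show "\<bar>energy \<gamma> q v\<bar> \<le> 1 / 2 * b * b\<^sup>2 + 1 / (\<gamma> * (\<gamma> - 1)) * b powr \<gamma>"
      unfolding energy_def using 1 2 3 4 by linarith
    have "\<bar>1 / 2 * q * (norm v)\<^sup>2 + 1 / (\<gamma> - 1) * q powr \<gamma>\<bar> \<le> 1 / 2 * b * b\<^sup>2 + 1 / (\<gamma> - 1) * b powr \<gamma>"
      using 1 2 3 4 by linarith
    then show "norm (energy_flux \<gamma> q v) \<le> (1 / 2 * b * b\<^sup>2 + 1 / (\<gamma> - 1) * b powr \<gamma>) * b"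
      unfolding energy_flux_def norm_scaleR using that by (intro mult_mono) auto
  qed
  have i1: "integrable M (\<lambda>z. energy \<gamma> (\<rho> z) (u z) * D z)"
    by (rule integrable_mult_AE_bounded[OF integrable_dt Em(1) eventually_mono[OF B(2) Eb]])
  have i2: "integrable M (\<lambda>z. energy_flux \<gamma> (\<rho> z) (u z) \<bullet> G z)"
    by (rule integrable_inner_AE_bounded[OF integrable_grad Em(2) eventually_mono[OF B(2) Fb]])
  have i3: "integrable M (\<lambda>z. \<rho> z * D z)"
    by (rule integrable_mult_AE_bounded[OF integrable_dt m(1), of B])
      (use B(2) in \<open>eventually_elim, auto\<close>)
  have i4: "integrable M (\<lambda>z. \<rho> z * (u z \<bullet> G z))"
  proof (rule integrable_mult_AE_bounded[OF _ m(1), of _ B])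
    show "integrable M (\<lambda>z. u z \<bullet> G z)"
      by (rule integrable_inner_AE_bounded[OF integrable_grad m(2), of B])
        (use B(2) in \<open>eventually_elim, auto\<close>)
  qed (use B(2) in \<open>eventually_elim, auto\<close>)
  have j1: "integrable lebesgue (\<lambda>x. energy \<gamma> (\<rho>\<^sub>0 x) (u\<^sub>0 x) * \<phi> (0, x))"
    by (rule integrable_mult_AE_bounded[OF integrable_initial Em(3) eventually_mono[OF B0(2) Eb]])
  have j2: "integrable lebesgue (\<lambda>x. \<rho>\<^sub>0 x * \<phi> (0, x))"
    by (rule integrable_mult_AE_bounded[OF integrable_initial m(3), of B0])
      (use B0(2) in \<open>eventually_elim, auto\<close>)
  have E: "0 \<le> (LINT z|M. energy \<gamma> (\<rho> z) (u z) * D z + energy_flux \<gamma> (\<rho> z) (u z) \<bullet> G z)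
        + (LINT x|lebesgue. energy \<gamma> (\<rho>\<^sub>0 x) (u\<^sub>0 x) * \<phi> (0, x))"
  proof -
    have "0 \<le> (LINT z|M. energy \<gamma> (\<rho> z) (u z) * dt \<phi> z + energy_flux \<gamma> (\<rho> z) (u z) \<bullet> grad \<phi> z)
        + (LINT x|lebesgue. energy \<gamma> (\<rho>\<^sub>0 x) (u\<^sub>0 x) * \<phi> (0, x))"
      using ent tf nonneg unfolding entropy_admissible_def by blast
    also have "(LINT z|M. energy \<gamma> (\<rho> z) (u z) * dt \<phi> z + energy_flux \<gamma> (\<rho> z) (u z) \<bullet> grad \<phi> z)
        = (LINT z|M. energy \<gamma> (\<rho> z) (u z) * D z + energy_flux \<gamma> (\<rho> z) (u z) \<bullet> G z)"
      unfolding gr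
    proof (rule integral_cong_AE)
      show "AE z in M. energy \<gamma> (\<rho> z) (u z) * dt \<phi> z + energy_flux \<gamma> (\<rho> z) (u z) \<bullet> G z = energy \<gamma> (\<rho> z) (u z) * D z + energy_flux \<gamma> (\<rho> z) (u z) \<bullet> G z"
        using dtae' by eventually_elim simp
    qed measurable
    finally show ?thesis .
  qed
  have R: "(LINT z|M. \<rho> z * D z + \<rho> z * (u z \<bullet> G z)) + (LINT x|lebesgue. \<rho>\<^sub>0 x * \<phi> (0, x)) = 0"
  proof -
    have "(LINT z|M. \<rho> z * dt \<phi> z + \<rho> z * (u z \<bullet> grad \<phi> z)) + (LINT x|lebesgue. \<rho>\<^sub>0 x * \<phi> (0, x)) = 0"
      using ws tf unfolding weak_solution_def by blast
    also have "(LINT z|M. \<rho> z * dt \<phi> z + \<rho> z * (u z \<bullet> grad \<phi> z))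
        = (LINT z|M. \<rho> z * D z + \<rho> z * (u z \<bullet> G z))"
      unfolding gr
    proof (rule integral_cong_AE)
      show "AE z in M. \<rho> z * dt \<phi> z + \<rho> z * (u z \<bullet> G z) = \<rho> z * D z + \<rho> z * (u z \<bullet> G z)"
        using dtae' by eventually_elim simp
    qed measurable
    finally show ?thesis .
  qed
  have 1: "(LINT z|M. D z) + (LINT x|lebesgue. \<phi> (0, x)) = 0"
    by (rule integral_cone_test_dt[OF hyp(1,2,4-6)])
  let ?k = "1 / (\<gamma> - 1)" and ?l = "1 / \<gamma>"
  have "(LINT z|M. rel_energy \<gamma> (\<rho> z) (u z) * D z + rel_flux \<gamma> (\<rho> z) (u z) \<bullet> G z)
      = (LINT z|M. (energy \<gamma> (\<rho> z) (u z) * D z + energy_flux \<gamma> (\<rho> z) (u z) \<bullet> G z)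
           - ?k * (\<rho> z * D z + \<rho> z * (u z \<bullet> G z)) + ?l * D z)"
    by (rule Bochner_Integration.integral_cong[OF refl])
      (simp add: rel_energy_def rel_flux_def inner_diff_left algebra_simps)
  also have "\<dots> = (LINT z|M. energy \<gamma> (\<rho> z) (u z) * D z + energy_flux \<gamma> (\<rho> z) (u z) \<bullet> G z)
      - ?k * (LINT z|M. \<rho> z * D z + \<rho> z * (u z \<bullet> G z)) + ?l * (LINT z|M. D z)"
    using i1 i2 i3 i4 integrable_dt by simp
  finally have A: "(LINT z|M. rel_energy \<gamma> (\<rho> z) (u z) * D z + rel_flux \<gamma> (\<rho> z) (u z) \<bullet> G z) = \<dots>" .
  have "(LINT x|lebesgue. rel_energy \<gamma> (\<rho>\<^sub>0 x) (u\<^sub>0 x) * \<phi> (0, x))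
      = (LINT x|lebesgue. energy \<gamma> (\<rho>\<^sub>0 x) (u\<^sub>0 x) * \<phi> (0, x)
           - ?k * (\<rho>\<^sub>0 x * \<phi> (0, x)) + ?l * \<phi> (0, x))"
    by (rule Bochner_Integration.integral_cong[OF refl])
      (simp add: rel_energy_def algebra_simps)
  also have "\<dots> = (LINT x|lebesgue. energy \<gamma> (\<rho>\<^sub>0 x) (u\<^sub>0 x) * \<phi> (0, x))
      - ?k * (LINT x|lebesgue. \<rho>\<^sub>0 x * \<phi> (0, x)) + ?l * (LINT x|lebesgue. \<phi> (0, x))"
    using j1 j2 integrable_initial by simp
  finally have Bq: "(LINT x|lebesgue. rel_energy \<gamma> (\<rho>\<^sub>0 x) (u\<^sub>0 x) * \<phi> (0, x)) = \<dots>" .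
  have "?k * ((LINT z|M. \<rho> z * D z + \<rho> z * (u z \<bullet> G z)) + (LINT x|lebesgue. \<rho>\<^sub>0 x * \<phi> (0, x))) = 0"
    "?l * ((LINT z|M. D z) + (LINT x|lebesgue. \<phi> (0, x))) = 0"
    unfolding R 1 by simp_all
  then show ?thesis unfolding A Bq using E by (simp only: distrib_left)
qed

end

section \<open>Propagation of rest from the initial time\<close>

text \<open>In the interior of the cone the integrand of the relative entropy inequality is at most
\<open>ramp_slope * H\<^sup>2 * \<eta> - 2 * ramp * H * (c * \<eta> - \<bar>q\<bar>)\<close>, and the last factor is at least \<open>m * \<eta>\<close> by the flux
bound.\<close>

lemma cone_energy_dissipation:
  fixes a h :: real and x\<^sub>0 :: space and r c d s t\<^sub>1 T m :: real
  defines "H \<equiv> cone_height x\<^sub>0 r c d s"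
  assumes hyp: "h > 0" "c > 0" "d > 0" "r - c * (t\<^sub>1 - s) \<le> d" "t\<^sub>1 < T" "0 < T"
    and g: "\<gamma> > 1" and ent: "entropy_admissible \<gamma> T \<rho> u \<rho>\<^sub>0 u\<^sub>0"
    and flux: "AE z in lebesgue_on (slab T).
      norm (rel_flux \<gamma> (\<rho> z) (u z)) + m * rel_energy \<gamma> (\<rho> z) (u z) \<le> c * rel_energy \<gamma> (\<rho> z) (u z)"
    and m: "m \<ge> 0"
  shows "integrable (lebesgue_on (slab T)) (\<lambda>z. rel_energy \<gamma> (\<rho> z) (u z) * (ramp a h (fst z) * H z))"
    and "integrable (lebesgue_on (slab T)) (\<lambda>z. rel_energy \<gamma> (\<rho> z) (u z) * (ramp_slope a h (fst z) * (H z)\<^sup>2))"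
    and "2 * m * (LINT z|lebesgue_on (slab T). rel_energy \<gamma> (\<rho> z) (u z) * (ramp a h (fst z) * H z))
      \<le> (LINT z|lebesgue_on (slab T). rel_energy \<gamma> (\<rho> z) (u z) * (ramp_slope a h (fst z) * (H z)\<^sup>2))
        + (LINT x|lebesgue. rel_energy \<gamma> (\<rho>\<^sub>0 x) (u\<^sub>0 x) * cone_test a h x\<^sub>0 r c d s (0, x))"
proof -
  let ?M = "lebesgue_on (slab T)"
  let ?\<eta> = "\<lambda>z. rel_energy \<gamma> (\<rho> z) (u z)" and ?q = "\<lambda>z. rel_flux \<gamma> (\<rho> z) (u z)"
  let ?D = "cone_test_dt a h x\<^sub>0 r c d s" and ?G = "cone_test_grad a h x\<^sub>0 r c d s"
  let ?\<theta> = "\<lambda>z. ramp a h (fst z)" and ?\<theta>' = "\<lambda>z. ramp_slope a h (fst z)"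
  have st: "Linf_state (slab T) \<rho> u"
    using ent by (simp add: entropy_admissible_def weak_solution_def)
  have meas [measurable]: "\<rho> \<in> borel_measurable ?M" "u \<in> borel_measurable ?M"
    using st by (auto simp: Linf_state_def)
  have \<eta>m: "?\<eta> \<in> borel_measurable ?M" and qm: "?q \<in> borel_measurable ?M"
    unfolding rel_energy_def rel_flux_def energy_def energy_flux_def by measurable
  obtain B where B: "B > 0" "AE z in ?M. 0 < \<rho> z \<and> \<rho> z \<le> B \<and> norm (u z) \<le> B"
    using Linf_state_AE_bound[OF st] by blast
  obtain L where L: "L > 0" "\<And>r v. 0 < r \<Longrightarrow> r \<le> B \<Longrightarrow> norm v \<le> B \<Longrightarrow> rel_energy \<gamma> r v \<le> L * norm (r - 1, v)"
    using rel_energy_lipschitz_at_rest[OF g B(1)] by blast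
  define b where "b = L * (B + 1 + B)"
  have \<eta>b: "AE z in ?M. \<bar>?\<eta> z\<bar> \<le> b"
    using B(2)
  proof eventually_elim
    fix z assume z: "0 < \<rho> z \<and> \<rho> z \<le> B \<and> norm (u z) \<le> B"
    then have "\<bar>?\<eta> z\<bar> = ?\<eta> z" using rel_energy_nonneg[OF g] by simp
    also have "\<dots> \<le> L * norm (\<rho> z - 1, u z)" using L(2) z by blast
    also have "norm (\<rho> z - 1, u z) \<le> norm (\<rho> z - 1) + norm (u z)" by (rule norm_Pair_le)
    also have "\<dots> \<le> B + 1 + B" using z by auto
    finally show "\<bar>?\<eta> z\<bar> \<le> b" using L(1) by (simp add: b_def)
  qed
  have qb: "AE z in ?M. norm (?q z) \<le> c * b"
    using flux \<eta>b B(2)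
  proof eventually_elim
    fix z assume z: "norm (?q z) + m * ?\<eta> z \<le> c * ?\<eta> z" "\<bar>?\<eta> z\<bar> \<le> b" "0 < \<rho> z \<and> \<rho> z \<le> B \<and> norm (u z) \<le> B"
    have "0 \<le> m * ?\<eta> z" using m rel_energy_nonneg[OF g] z(3) by simp
    moreover have "c * ?\<eta> z \<le> c * b" using hyp(2) z(2) by (intro mult_left_mono) auto
    ultimately show "norm (?q z) \<le> c * b" using z(1) by linarith
  qed
  show i1: "integrable ?M (\<lambda>z. ?\<eta> z * (?\<theta> z * H z))"
    unfolding H_def by (rule integrable_mult_AE_bounded[OF integrable_ramp_height[OF hyp] \<eta>m \<eta>b])
  show i2: "integrable ?M (\<lambda>z. ?\<eta> z * (?\<theta>' z * (H z)\<^sup>2))"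
    unfolding H_def by (rule integrable_mult_AE_bounded[OF integrable_slope_height[OF hyp] \<eta>m \<eta>b])
  have i3: "integrable ?M (\<lambda>z. ?\<eta> z * ?D z)"
    by (rule integrable_mult_AE_bounded[OF integrable_dt[OF hyp] \<eta>m \<eta>b])
  have i4: "integrable ?M (\<lambda>z. ?q z \<bullet> ?G z)"
    by (rule integrable_inner_AE_bounded[OF integrable_grad[OF hyp] qm qb])
  have "(LINT z|?M. ?\<eta> z * ?D z + ?q z \<bullet> ?G z)
      \<le> (LINT z|?M. ?\<eta> z * (?\<theta>' z * (H z)\<^sup>2) - 2 * m * (?\<eta> z * (?\<theta> z * H z)))"
  proof (rule integral_mono_AE)
    show "AE z in ?M. ?\<eta> z * ?D z + ?q z \<bullet> ?G z
        \<le> ?\<eta> z * (?\<theta>' z * (H z)\<^sup>2) - 2 * m * (?\<eta> z * (?\<theta> z * H z))"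
      using flux
    proof eventually_elim
      fix z assume z: "norm (?q z) + m * ?\<eta> z \<le> c * ?\<eta> z"
      have w: "?\<theta> z * H z \<ge> 0" by (simp add: H_def ramp_bounds)
      have "?q z \<bullet> ?G z \<le> norm (?q z) * norm (?G z)"
        using Cauchy_Schwarz_ineq2[of "?q z" "?G z"] by linarith
      also have "\<dots> \<le> norm (?q z) * (2 * (?\<theta> z * H z))"
        unfolding H_def by (intro mult_left_mono norm_cone_test_grad) auto
      also have "\<dots> \<le> (c * ?\<eta> z - m * ?\<eta> z) * (2 * (?\<theta> z * H z))"
        using z w by (intro mult_right_mono) auto
      finally show "?\<eta> z * ?D z + ?q z \<bullet> ?G z
        \<le> ?\<eta> z * (?\<theta>' z * (H z)\<^sup>2) - 2 * m * (?\<eta> z * (?\<theta> z * H z))"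
        unfolding cone_test_dt_def H_def[symmetric] by (simp add: algebra_simps)
    qed
  qed (use i1 i2 i3 i4 in auto)
  also have "\<dots> = (LINT z|?M. ?\<eta> z * (?\<theta>' z * (H z)\<^sup>2)) - 2 * m * (LINT z|?M. ?\<eta> z * (?\<theta> z * H z))"
    using i1 i2 by simp
  finally show "2 * m * (LINT z|?M. ?\<eta> z * (?\<theta> z * H z)) \<le> (LINT z|?M. ?\<eta> z * (?\<theta>' z * (H z)\<^sup>2))
        + (LINT x|lebesgue. rel_energy \<gamma> (\<rho>\<^sub>0 x) (u\<^sub>0 x) * cone_test a h x\<^sub>0 r c d s (0, x))"
    using rel_entropy_inequality[OF hyp g ent, of a x\<^sub>0] by linarith
qed

text \<open>The set where the weight \<open>w\<close> is positive is relatively open, and the relative energy vanishes only at rest.\<close>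

lemma notin_ess_supp_disturbance:
  fixes w :: "spacetime \<Rightarrow> real"
  assumes g: "\<gamma> > 1" and st: "Linf_state (slab T) \<rho> u"
    and w: "continuous_on UNIV w" "w z > 0" "z \<in> slab T"
    and ae: "AE z in lebesgue_on (slab T). rel_energy \<gamma> (\<rho> z) (u z) * w z = 0"
  shows "z \<notin> ess_supp (slab T) (\<lambda>z. (\<rho> z - 1, u z))"
proof -
  let ?U = "slab T \<inter> {z. 0 < w z}"
  have "open {z. 0 < w z}" by (rule open_Collect_less[OF continuous_on_const w(1)])
  then have op: "openin (top_of_set (slab T)) ?U" by (simp add: openin_open_Int)
  have "AE z in lebesgue_on (slab T). \<rho> z > 0" using st by (simp add: Linf_state_def)
  with ae have "AE z in lebesgue_on (slab T). 0 < w z \<longrightarrow> (\<rho> z - 1, u z) = 0"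
  proof eventually_elim
    fix z assume "rel_energy \<gamma> (\<rho> z) (u z) * w z = 0" "\<rho> z > 0"
    then show "0 < w z \<longrightarrow> (\<rho> z - 1, u z) = 0"
      using rel_energy_eq_0[OF g, of "\<rho> z" "u z"] by (auto simp: zero_prod_def)
  qed
  then have "AE z in lebesgue. z \<in> slab T \<longrightarrow> 0 < w z \<longrightarrow> (\<rho> z - 1, u z) = 0"
    by (simp add: AE_restrict_space_iff)
  then have ae1: "AE z in lebesgue. z \<in> ?U \<longrightarrow> (\<rho> z - 1, u z) = 0"
    by eventually_elim auto
  have "{z. 0 < w z} \<in> sets lebesgue" using \<open>open {z. 0 < w z}\<close> by simp
  then have "?U \<in> sets lebesgue" by auto
  with ae1 have "AE z in lebesgue_on ?U. (\<rho> z - 1, u z) = 0"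
    by (simp add: AE_restrict_space_iff)
  then show ?thesis using op w(2,3) unfolding ess_supp_def by blast
qed

lemma continuous_on_ramp_height: "continuous_on A (\<lambda>z. ramp a h (fst z) * cone_height x\<^sub>0 r c d s z)"
  by (intro continuous_intros continuous_on_cone_height)

text \<open>A cone whose tip is rounded so little that it still contains a given point on the axis, while its support
ends before the final time.\<close>

lemma cone_parameters:
  fixes c :: real
  assumes "c > 0" "c * (t - s) < r" "t < T"
  obtains t\<^sub>1 d where "t < t\<^sub>1" "t\<^sub>1 < T" "d > 0" "d = r - c * (t\<^sub>1 - s)"
    "cone_height x\<^sub>0 r c d s (t, x\<^sub>0) > 0"
proof -
  have tr: "t < s + r / c" using assms by (simp add: field_simps)
  then have "t < min T (s + r / c)" using assms by simp
  from dense[OF this] obtain t\<^sub>1 where 1: "t < t\<^sub>1" "t\<^sub>1 < T" "t\<^sub>1 < s + r / c" by auto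
  have "c * t\<^sub>1 < c * (s + r / c)" using 1 assms by simp
  then have 2: "r - c * (t\<^sub>1 - s) > 0" using assms by (simp add: algebra_simps)
  have "c * t < c * t\<^sub>1" using 1 assms by simp
  then have "cone_height x\<^sub>0 r c (r - c * (t\<^sub>1 - s)) s (t, x\<^sub>0) > 0"
    using 2 by (simp add: cone_height_def norm_Pair algebra_simps)
  then show thesis using that 1 2 by blast
qed

text \<open>With the ramp equal to 1 from time 0 on, the initial term is the only source of energy, and
it vanishes because the base of the cone is at rest.\<close>

lemma rest_cone_initial:
  assumes g: "\<gamma> > 1" and ent: "entropy_admissible \<gamma> T \<rho> u \<rho>\<^sub>0 u\<^sub>0" and m: "m > 0" and c: "c > 0"
    and flux: "AE z in lebesgue_on (slab T).
      norm (rel_flux \<gamma> (\<rho> z) (u z)) + m * rel_energy \<gamma> (\<rho> z) (u z) \<le> c * rel_energy \<gamma> (\<rho> z) (u z)"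
    and rest: "AE x in lebesgue. x \<in> ball x\<^sub>0 r \<longrightarrow> \<rho>\<^sub>0 x = 1 \<and> u\<^sub>0 x = 0"
    and t: "0 \<le> t" "t < T" "c * t < r"
  shows "(t, x\<^sub>0) \<notin> ess_supp (slab T) (\<lambda>z. (\<rho> z - 1, u z))"
proof -
  let ?M = "lebesgue_on (slab T)"
  have st: "Linf_state (slab T) \<rho> u" 
    using ent by (auto simp add: entropy_admissible_def weak_solution_def)
  obtain t\<^sub>1 d where td: "t < t\<^sub>1" "t\<^sub>1 < T" "d > 0" "d = r - c * (t\<^sub>1 - 0)"
    and pos: "cone_height x\<^sub>0 r c d 0 (t, x\<^sub>0) > 0"
    using cone_parameters[OF c, of t 0 r T] t by auto
  let ?H = "cone_height x\<^sub>0 r c d 0"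
  \<comment> \<open>Only the values of the ramp on the slab matter, where it is constant.\<close>
  have ramp1: "ramp (-1) 1 q = 1" if "q \<ge> 0" for q :: real
    using that by (simp add: ramp_def)
  have slope0: "ramp_slope (-1) 1 q = 0" if "q \<ge> 0" for q :: real
    using that by (simp add: ramp_slope_def)
  note diss = cone_energy_dissipation[of 1 c d r t\<^sub>1 0 T \<gamma> \<rho> u \<rho>\<^sub>0 u\<^sub>0 m "-1" x\<^sub>0, OF _ c td(3) _ td(2) _ g ent flux]
  have int: "integrable ?M (\<lambda>z. rel_energy \<gamma> (\<rho> z) (u z) * (ramp (-1) 1 (fst z) * ?H z))"
    and le: "2 * m * (LINT z|?M. rel_energy \<gamma> (\<rho> z) (u z) * (ramp (-1) 1 (fst z) * ?H z))
      \<le> (LINT z|?M. rel_energy \<gamma> (\<rho> z) (u z) * (ramp_slope (-1) 1 (fst z) * (?H z)\<^sup>2))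
        + (LINT x|lebesgue. rel_energy \<gamma> (\<rho>\<^sub>0 x) (u\<^sub>0 x) * cone_test (-1) 1 x\<^sub>0 r c d 0 (0, x))"
    using diss(1,3) td m t by auto
  have "(LINT z|?M. rel_energy \<gamma> (\<rho> z) (u z) * (ramp_slope (-1) 1 (fst z) * (?H z)\<^sup>2)) = (LINT z|?M. 0)"
    by (rule Bochner_Integration.integral_cong[OF refl])
      (auto simp: slope0 slab_def space_restrict_space)
  moreover have "(LINT x|lebesgue. rel_energy \<gamma> (\<rho>\<^sub>0 x) (u\<^sub>0 x) * cone_test (-1) 1 x\<^sub>0 r c d 0 (0, x)) = 0"
  proof (rule integral_eq_zero_AE)
    show "AE x in lebesgue. rel_energy \<gamma> (\<rho>\<^sub>0 x) (u\<^sub>0 x) * cone_test (-1) 1 x\<^sub>0 r c d 0 (0, x) = 0"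
      using rest
    proof eventually_elim
      fix x assume x: "x \<in> ball x\<^sub>0 r \<longrightarrow> \<rho>\<^sub>0 x = 1 \<and> u\<^sub>0 x = 0"
      show "rel_energy \<gamma> (\<rho>\<^sub>0 x) (u\<^sub>0 x) * cone_test (-1) 1 x\<^sub>0 r c d 0 (0, x) = 0"
      proof (cases "x \<in> ball x\<^sub>0 r")
        case True
        then show ?thesis using x rel_energy_eq_0[OF g, of 1 0] by simp
      next
        case False
        then have "?H (0, x) = 0"
          using cone_height_support(1)[of x\<^sub>0 r c d 0 "(0, x)"]
          by (auto simp: dist_norm norm_minus_commute)
        then show ?thesis by (simp add: cone_test_def)
      qed
    qed
  qed
  ultimately have le0: "2 * m * (LINT z|?M. rel_energy \<gamma> (\<rho> z) (u z) * (ramp (-1) 1 (fst z) * ?H z)) \<le> 0"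
    using le by simp
  have nn: "AE z in ?M. 0 \<le> rel_energy \<gamma> (\<rho> z) (u z) * (ramp (-1) 1 (fst z) * ?H z)"
  proof -
    have "AE z in ?M. \<rho> z > 0" using st by (simp add: Linf_state_def)
    then show ?thesis by eventually_elim (simp add: rel_energy_nonneg[OF g] ramp_bounds)
  qed
  have "(LINT z|?M. rel_energy \<gamma> (\<rho> z) (u z) * (ramp (-1) 1 (fst z) * ?H z)) = 0"
    using le0 integral_nonneg_AE[OF nn] m by (simp add: mult_le_0_iff)
  then have ae: "AE z in ?M. rel_energy \<gamma> (\<rho> z) (u z) * (ramp (-1) 1 (fst z) * ?H z) = 0"
    using integral_nonneg_eq_0_iff_AE[OF int nn] by simp
  show ?thesis
    by (rule notin_ess_supp_disturbance[OF g st continuous_on_ramp_height _ _ ae])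
      (use pos t in \<open>auto simp: ramp1 slab_def\<close>)
qed

section \<open>Propagation of rest from a Lebesgue time\<close>

lemma integrable_indicator_box_disturbance:
  assumes st: "Linf_state (slab T) \<rho> u" and K: "compact K" and I: "0 \<le> a" "b < T"
  shows "integrable (lebesgue_on (slab T)) (\<lambda>z. norm (\<rho> z - 1, u z) * indicator ({a..b} \<times> K) z)"
proof -
  let ?M = "lebesgue_on (slab T)"
  have cK: "compact ({a..b} \<times> K)" using K by (intro compact_Times) auto
  have [measurable]: "\<rho> \<in> borel_measurable ?M" "u \<in> borel_measurable ?M"
    using st by (auto simp: Linf_state_def)
  obtain B where B: "B > 0" "AE z in ?M. 0 < \<rho> z \<and> \<rho> z \<le> B \<and> norm (u z) \<le> B"
    using Linf_state_AE_bound[OF st] by blast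
  show ?thesis
  proof (rule integrable_mult_AE_bounded)
    have "{a..b} \<times> K \<in> sets borel" using cK by (intro borel_closed compact_imp_closed)
    then show "integrable ?M (indicator ({a..b} \<times> K) :: _ \<Rightarrow> real)"
      by (intro integrable_slab_bounded[OF _ cK, where B=1]) (auto simp: indicator_def)
    show "(\<lambda>z. norm (\<rho> z - 1, u z)) \<in> borel_measurable ?M"
      unfolding norm_Pair by measurable
    show "AE z in ?M. \<bar>norm (\<rho> z - 1, u z)\<bar> \<le> B + 1 + B"
      using B(2)
    proof eventually_elim
      fix z assume z: "0 < \<rho> z \<and> \<rho> z \<le> B \<and> norm (u z) \<le> B"
      have "norm (\<rho> z - 1, u z) \<le> norm (\<rho> z - 1) + norm (u z)" by (rule norm_Pair_le)
      also have "\<dots> \<le> B + 1 + B" using z by auto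
      finally show "\<bar>norm (\<rho> z - 1, u z)\<bar> \<le> B + 1 + B" by simp
    qed
  qed
qed

text \<open>Fubini's theorem connects the space-time integral, which bounds the energy near the Lebesgue time, with
the iterated integral in the definition of a Lebesgue value.\<close>

lemma box_integral_disturbance:
  assumes st: "Linf_state (slab T) \<rho> u" and K: "compact K" and I: "0 \<le> a" "b < T"
    and rest: "AE x in lebesgue. x \<in> K \<longrightarrow> \<rho>\<^sub>\<sigma> x = 1 \<and> u\<^sub>\<sigma> x = 0"
  shows "(LINT z|lebesgue_on (slab T). norm (\<rho> z - 1, u z) * indicator ({a..b} \<times> K) z)
    = (LINT t|lebesgue_on {a..b}. LINT x|lebesgue_on K. norm ((\<rho> (t, x), u (t, x)) - (\<rho>\<^sub>\<sigma> x, u\<^sub>\<sigma> x)))"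
proof -
  let ?M = "lebesgue_on (slab T)"
  let ?f = "\<lambda>z. norm (\<rho> z - 1, u z) * indicator ({a..b} \<times> K) z"
  have Km: "K \<in> sets lebesgue" using borel_closed[OF compact_imp_closed[OF K]] by simp
  have ind: "indicator (slab T) z *\<^sub>R ?f z = ?f z" for z
    using I by (auto simp: slab_def indicator_def)
  have "integrable lebesgue (\<lambda>z. indicator (slab T) z *\<^sub>R ?f z)"
    using integrable_indicator_box_disturbance[OF st K I] by (subst (asm) integrable_restrict_space) auto
  then have int: "integrable lebesgue ?f" unfolding ind .
  have "integral\<^sup>L ?M ?f = (LINT z|lebesgue. indicator (slab T) z *\<^sub>R ?f z)"
    by (rule integral_restrict_space) simp
  also have "\<dots> = integral\<^sup>L lebesgue ?f" unfolding ind ..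
  also have "\<dots> = (LINT t|lebesgue. LINT x|lebesgue. ?f (t, x))"
    by (rule integral_lebesgue_fst[OF int])
  also have "\<dots> = (LINT t|lebesgue. indicator {a..b} t *\<^sub>R
      (LINT x|lebesgue_on K. norm ((\<rho> (t, x), u (t, x)) - (\<rho>\<^sub>\<sigma> x, u\<^sub>\<sigma> x))))"
  proof (rule Bochner_Integration.integral_cong[OF refl])
    fix t
    have "(LINT x|lebesgue. ?f (t, x))
        = (LINT x|lebesgue. indicator {a..b} t * (indicator K x *\<^sub>R norm ((\<rho> (t, x), u (t, x)) - (\<rho>\<^sub>\<sigma> x, u\<^sub>\<sigma> x))))"
      by (rule integral_lebesgue_cong_AE, use rest in eventually_elim) (auto simp: indicator_def)
    also have "\<dots> = indicator {a..b} t * (LINT x|lebesgue. indicator K x *\<^sub>R norm ((\<rho> (t, x), u (t, x)) - (\<rho>\<^sub>\<sigma> x, u\<^sub>\<sigma> x)))"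
      by (rule integral_mult_right_zero)
    also have "(LINT x|lebesgue. indicator K x *\<^sub>R norm ((\<rho> (t, x), u (t, x)) - (\<rho>\<^sub>\<sigma> x, u\<^sub>\<sigma> x)))
        = (LINT x|lebesgue_on K. norm ((\<rho> (t, x), u (t, x)) - (\<rho>\<^sub>\<sigma> x, u\<^sub>\<sigma> x)))"
      by (rule integral_restrict_space[symmetric]) (use Km in simp)
    finally show "(LINT x|lebesgue. ?f (t, x)) = indicator {a..b} t *\<^sub>R
      (LINT x|lebesgue_on K. norm ((\<rho> (t, x), u (t, x)) - (\<rho>\<^sub>\<sigma> x, u\<^sub>\<sigma> x)))"
      by simp
  qed
  also have "\<dots> = (LINT t|lebesgue_on {a..b}. LINT x|lebesgue_on K. norm ((\<rho> (t, x), u (t, x)) - (\<rho>\<^sub>\<sigma> x, u\<^sub>\<sigma> x)))"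
    by (rule integral_restrict_space[symmetric]) simp
  finally show ?thesis .
qed

text \<open>The ramp on \<open>[\<sigma>, \<sigma> + h]\<close> removes the initial data and introduces a term that is bounded by the mean
disturbance over \<open>[\<sigma> - h, \<sigma> + h]\<close>, which tends to 0. As the ramps increase when \<open>h\<close> decreases, the energy
weighted with one fixed ramp is bounded by all of these means, hence is 0.\<close>

lemma rest_cone_lebesgue_time:
  assumes g: "\<gamma> > 1" and ent: "entropy_admissible \<gamma> T \<rho> u \<rho>\<^sub>0 u\<^sub>0" and m: "m > 0" and c: "c > 0"
    and flux: "AE z in lebesgue_on (slab T).
      norm (rel_flux \<gamma> (\<rho> z) (u z)) + m * rel_energy \<gamma> (\<rho> z) (u z) \<le> c * rel_energy \<gamma> (\<rho> z) (u z)"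
    and leb: "lebesgue_value T \<rho> u \<sigma> \<rho>\<^sub>\<sigma> u\<^sub>\<sigma>"
    and rest: "AE x in lebesgue. x \<in> cball x\<^sub>0 r \<longrightarrow> \<rho>\<^sub>\<sigma> x = 1 \<and> u\<^sub>\<sigma> x = 0"
    and t: "\<sigma> < t" "t < T" "c * (t - \<sigma>) < r"
  shows "(t, x\<^sub>0) \<notin> ess_supp (slab T) (\<lambda>z. (\<rho> z - 1, u z))"
proof -
  let ?M = "lebesgue_on (slab T)" and ?K = "cball x\<^sub>0 r"
  let ?\<eta> = "\<lambda>z. rel_energy \<gamma> (\<rho> z) (u z)" and ?N = "\<lambda>z. norm (\<rho> z - 1, u z)"
  have \<sigma>: "0 < \<sigma>" "\<sigma> < T" using leb by (auto simp: lebesgue_value_def)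
  have st: "Linf_state (slab T) \<rho> u" 
    using ent by (auto simp add: entropy_admissible_def weak_solution_def)
  have posae: "AE z in ?M. \<rho> z > 0" using st by (simp add: Linf_state_def)
  obtain B where B: "B > 0" "AE z in ?M. 0 < \<rho> z \<and> \<rho> z \<le> B \<and> norm (u z) \<le> B"
    using Linf_state_AE_bound[OF st] by blast
  obtain L where L: "L > 0" "\<And>r v. 0 < r \<Longrightarrow> r \<le> B \<Longrightarrow> norm v \<le> B \<Longrightarrow> rel_energy \<gamma> r v \<le> L * norm (r - 1, v)"
    using rel_energy_lipschitz_at_rest[OF g B(1)] by blast
  obtain t\<^sub>1 d where td: "t < t\<^sub>1" "t\<^sub>1 < T" "d > 0" "d = r - c * (t\<^sub>1 - \<sigma>)"
    and pos: "cone_height x\<^sub>0 r c d \<sigma> (t, x\<^sub>0) > 0"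
    using cone_parameters[OF c t(3,2)] by metis
  let ?H = "cone_height x\<^sub>0 r c d \<sigma>"
  let ?E = "\<lambda>h. LINT z|?M. ?\<eta> z * (ramp \<sigma> h (fst z) * ?H z)"
  let ?A = "\<lambda>h. 1 / (2 * h) * (LINT t|lebesgue_on {\<sigma> - h..\<sigma> + h}. LINT x|lebesgue_on ?K.
      norm ((\<rho> (t, x), u (t, x)) - (\<rho>\<^sub>\<sigma> x, u\<^sub>\<sigma> x)))"
  \<comment> \<open>For smaller \<open>h\<close> the interval \<open>[\<sigma> - h, \<sigma> + h]\<close> stays inside the slab.\<close>
  define \<epsilon> where "\<epsilon> = min \<sigma> (T - \<sigma>)"
  have \<epsilon>: "\<epsilon> > 0" using \<sigma> by (simp add: \<epsilon>_def)
  have hyp: "c > 0" "d > 0" "r - c * (t\<^sub>1 - \<sigma>) \<le> d" "t\<^sub>1 < T" "0 < T"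
    using c td t \<sigma> by auto
  have int: "integrable ?M (\<lambda>z. ?\<eta> z * (ramp \<sigma> h (fst z) * ?H z))" if "h > 0" for h
    using cone_energy_dissipation(1)[OF that hyp g ent flux] m by simp
  have nn: "AE z in ?M. 0 \<le> ?\<eta> z * (ramp \<sigma> h (fst z) * ?H z)" for h
    using posae by eventually_elim (simp add: rel_energy_nonneg[OF g] ramp_bounds)
  have bound: "2 * m * ?E h \<le> 2 * L * r\<^sup>2 * ?A h" if h: "0 < h" "h < \<epsilon>" for h
  proof -
    have I: "0 \<le> \<sigma> - h" "\<sigma> + h < T" using h by (auto simp: \<epsilon>_def)
    have rest0: "ramp \<sigma> h 0 = 0" using \<sigma> h by (simp add: ramp_def divide_nonpos_pos)
    have "2 * m * ?E h \<le> (LINT z|?M. ?\<eta> z * (ramp_slope \<sigma> h (fst z) * (?H z)\<^sup>2))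
        + (LINT x|lebesgue. rel_energy \<gamma> (\<rho>\<^sub>0 x) (u\<^sub>0 x) * cone_test \<sigma> h x\<^sub>0 r c d \<sigma> (0, x))"
      using cone_energy_dissipation(3)[OF h(1) hyp g ent flux] m by simp
    also have "\<dots> = (LINT z|?M. ?\<eta> z * (ramp_slope \<sigma> h (fst z) * (?H z)\<^sup>2))"
      by (simp add: cone_test_def rest0)
    also have "\<dots> \<le> (LINT z|?M. L * r\<^sup>2 / h * (?N z * indicator ({\<sigma> - h..\<sigma> + h} \<times> ?K) z))"
    proof (rule integral_mono_AE)
      show "integrable ?M (\<lambda>z. ?\<eta> z * (ramp_slope \<sigma> h (fst z) * (?H z)\<^sup>2))"
        using cone_energy_dissipation(2)[OF h(1) hyp g ent flux] m by simp
      show "integrable ?M (\<lambda>z. L * r\<^sup>2 / h * (?N z * indicator ({\<sigma> - h..\<sigma> + h} \<times> ?K) z))"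
        using integrable_indicator_box_disturbance[OF st compact_cball I] by (rule integrable_mult_right)
      show "AE z in ?M. ?\<eta> z * (ramp_slope \<sigma> h (fst z) * (?H z)\<^sup>2)
          \<le> L * r\<^sup>2 / h * (?N z * indicator ({\<sigma> - h..\<sigma> + h} \<times> ?K) z)"
        using B(2)
      proof eventually_elim
        fix z assume z: "0 < \<rho> z \<and> \<rho> z \<le> B \<and> norm (u z) \<le> B"
        show "?\<eta> z * (ramp_slope \<sigma> h (fst z) * (?H z)\<^sup>2)
          \<le> L * r\<^sup>2 / h * (?N z * indicator ({\<sigma> - h..\<sigma> + h} \<times> ?K) z)"
        proof (cases "\<sigma> < fst z \<and> fst z < \<sigma> + h \<and> ?H z \<noteq> 0")
          case True
          have ct: "c * (fst z - \<sigma>) \<ge> 0" using True c by simp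
          then have "norm (snd z - x\<^sub>0) \<le> r"
            using cone_height_support(1)[of x\<^sub>0 r c d \<sigma> z] True by linarith
          then have zK: "z \<in> {\<sigma> - h..\<sigma> + h} \<times> ?K"
            using True h by (cases z) (auto simp: dist_norm norm_minus_commute)
          have "?H z \<le> r"
          proof -
            have "r - c * (fst z - \<sigma>) - norm (snd z - x\<^sub>0, d) \<le> r"
              using ct norm_ge_zero[of "(snd z - x\<^sub>0, d)"] by linarith
            moreover have "?H z = r - c * (fst z - \<sigma>) - norm (snd z - x\<^sub>0, d)"
              using True unfolding cone_height_def by (auto simp: max_def split: if_splits)
            ultimately show ?thesis by simp
          qed
          then have "(?H z)\<^sup>2 \<le> r\<^sup>2" by (intro power_mono) auto
          then have "?\<eta> z * (1 / h * (?H z)\<^sup>2) \<le> (L * ?N z) * (1 / h * r\<^sup>2)"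
            using L z h rel_energy_nonneg[OF g, of "\<rho> z" "u z"]
            by (intro mult_mono L(2) mult_left_mono) auto
          then show ?thesis using True zK by (simp add: ramp_slope_def field_simps)
        next
          case False
          then have "ramp_slope \<sigma> h (fst z) * (?H z)\<^sup>2 = 0" by (auto simp: ramp_slope_def)
          then show ?thesis using L h by (auto simp: zero_le_mult_iff zero_le_divide_iff)
        qed
      qed
    qed
    also have "\<dots> = L * r\<^sup>2 / h * (LINT z|?M. ?N z * indicator ({\<sigma> - h..\<sigma> + h} \<times> ?K) z)"
      by (rule integral_mult_right_zero)
    also have "\<dots> = 2 * L * r\<^sup>2 * ?A h"
      unfolding box_integral_disturbance[OF st compact_cball I rest] using h by simp
    finally show ?thesis .
  qed
  \<comment> \<open>The fixed ramp is already positive at time \<open>t\<close>.\<close>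
  define h\<^sub>0 where "h\<^sub>0 = min \<epsilon> (t - \<sigma>)"
  have h0: "h\<^sub>0 > 0" "h\<^sub>0 \<le> t - \<sigma>" "h\<^sub>0 \<le> \<epsilon>" using \<epsilon> t by (auto simp: h\<^sub>0_def)
  have mono: "?E h\<^sub>0 \<le> ?E h" if h: "0 < h" "h < h\<^sub>0" for h
  proof (rule integral_mono_AE[OF int[OF h0(1)] int[OF h(1)]])
    show "AE z in ?M. ?\<eta> z * (ramp \<sigma> h\<^sub>0 (fst z) * ?H z) \<le> ?\<eta> z * (ramp \<sigma> h (fst z) * ?H z)"
      using posae
    proof eventually_elim
      fix z assume z: "\<rho> z > 0"
      have "ramp \<sigma> h\<^sub>0 (fst z) \<le> ramp \<sigma> h (fst z)"
      proof (cases "fst z \<ge> \<sigma>")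
        case True
        then have "(fst z - \<sigma>) / h\<^sub>0 \<le> (fst z - \<sigma>) / h" using h by (intro divide_left_mono) auto
        then show ?thesis by (auto simp: ramp_def)
      next
        case False
        then show ?thesis using h by (simp add: ramp_def divide_nonpos_pos)
      qed
      then show "?\<eta> z * (ramp \<sigma> h\<^sub>0 (fst z) * ?H z) \<le> ?\<eta> z * (ramp \<sigma> h (fst z) * ?H z)"
        using rel_energy_nonneg[OF g z] by (intro mult_left_mono mult_right_mono) auto
    qed
  qed
  have "2 * m * ?E h\<^sub>0 \<le> 0"
  proof (rule tendsto_lowerbound)
    have "(?A \<longlongrightarrow> 0) (at_right 0)" using leb compact_cball unfolding lebesgue_value_def by blast
    then show "((\<lambda>h. 2 * L * r\<^sup>2 * ?A h) \<longlongrightarrow> 0) (at_right 0)" by (rule tendsto_mult_right_zero)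
    show "\<forall>\<^sub>F h in at_right 0. 2 * m * ?E h\<^sub>0 \<le> 2 * L * r\<^sup>2 * ?A h"
      unfolding eventually_at_right_field
    proof (intro exI conjI allI impI)
      fix h :: real assume h: "0 < h" "h < h\<^sub>0"
      have "2 * m * ?E h\<^sub>0 \<le> 2 * m * ?E h" using mono[OF h] m by (intro mult_left_mono) auto
      also have "\<dots> \<le> 2 * L * r\<^sup>2 * ?A h" using bound[of h] h h0 by simp
      finally show "2 * m * ?E h\<^sub>0 \<le> 2 * L * r\<^sup>2 * ?A h" .
    qed (rule h0)
  qed simp
  then have "?E h\<^sub>0 = 0"
    using integral_nonneg_AE[OF nn, of h\<^sub>0] m by (simp add: mult_le_0_iff)
  then have ae: "AE z in ?M. ?\<eta> z * (ramp \<sigma> h\<^sub>0 (fst z) * ?H z) = 0"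
    using integral_nonneg_eq_0_iff_AE[OF int[OF h0(1)] nn] by simp
  have "ramp \<sigma> h\<^sub>0 t > 0" using t h0 by (simp add: ramp_def)
  then show ?thesis
    using pos t \<sigma> by (intro notin_ess_supp_disturbance[OF g st continuous_on_ramp_height _ _ ae]) (auto simp: slab_def)
qed

section \<open>Finite speed of propagation\<close>

lemma AE_zero_outside_ess_supp:
  fixes S :: "'a::euclidean_space set" and f :: "'a \<Rightarrow> 'b::real_normed_vector"
  assumes S: "S \<in> sets lebesgue"
  shows "AE z in lebesgue. z \<in> S - ess_supp S f \<longrightarrow> f z = 0"
proof -
  define W where "W = \<Union>{U. openin (top_of_set S) U \<and> (AE z in lebesgue_on U. f z = 0)}"
  have "openin (top_of_set S) W" "AE z in lebesgue_on W. f z = 0"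
    unfolding W_def by (rule AE_zero_largest_openin[OF S])+
  moreover from this have "W \<in> sets lebesgue" using S by (auto simp: openin_open)
  moreover have "S - ess_supp S f \<subseteq> W" by (auto simp: ess_supp_def W_def)
  ultimately show ?thesis by (auto simp: AE_restrict_space_iff elim!: eventually_mono)
qed

lemma Linf_norm_sum_le_AE:
  assumes "Linf_norm S f + Linf_norm S g \<le> ennreal m" "m \<ge> 0"
  shows "AE z in lebesgue_on S. norm (f z) + norm (g z) \<le> m"
proof -
  have "AE z in lebesgue_on S. ennreal (norm (f z)) \<le> Linf_norm S f"
    "AE z in lebesgue_on S. ennreal (norm (g z)) \<le> Linf_norm S g"
    unfolding Linf_norm_def by (rule esssup_AE)+
  then show ?thesis
  proof eventually_elim
    fix z assume "ennreal (norm (f z)) \<le> Linf_norm S f" "ennreal (norm (g z)) \<le> Linf_norm S g"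
    then have "ennreal (norm (f z) + norm (g z)) \<le> Linf_norm S f + Linf_norm S g"
      by (simp add: ennreal_plus add_mono)
    then have "ennreal (norm (f z) + norm (g z)) \<le> ennreal m" using assms(1) by (rule order_trans)
    then show "norm (f z) + norm (g z) \<le> m" by (rule ennreal_le_iff[OF assms(2), THEN iffD1])
  qed
qed

lemma Linf_norm_eq_0I:
  assumes "f \<in> borel_measurable (lebesgue_on S)" "AE z in lebesgue_on S. f z = 0"
  shows "Linf_norm S f = 0"
proof -
  have "Linf_norm S f \<le> 0"
    unfolding Linf_norm_def
  proof (rule esssup_I)
    show "(\<lambda>z. ennreal (norm (f z))) \<in> borel_measurable (lebesgue_on S)" using assms(1) by measurable
    show "AE z in lebesgue_on S. ennreal (norm (f z)) \<le> 0" using assms(2) by eventually_elim simp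
  qed
  then show ?thesis by simp
qed

lemma cone_region_subset:
  assumes "\<alpha> > 0"
  shows "cone_region T V \<alpha> \<subseteq> slab T \<inter> {z. fst z \<le> \<alpha> * infdist (snd z) (- V)}"
proof -
  have "closed {z::spacetime. fst z \<le> \<alpha> * infdist (snd z) (- V)}"
    by (intro closed_Collect_le continuous_intros)
  moreover have "{z \<in> slab T. cone_weight V \<alpha> z \<noteq> 0} \<subseteq> {z. fst z \<le> \<alpha> * infdist (snd z) (- V)}"
    using assms by (auto simp: cone_weight_def max_def field_simps split: if_splits)
  ultimately show ?thesis unfolding cone_region_def using closure_minimal by blast
qed

lemma cone_region_measurable: "cone_region T V \<alpha> \<in> sets lebesgue"
  unfolding cone_region_def by (intro sets.Int borel_closed[THEN sets_completionI_sets]) auto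

lemma ball_infdist_subset: "ball x (infdist x (- V)) \<subseteq> V"
proof
  fix y assume y: "y \<in> ball x (infdist x (- V))"
  show "y \<in> V"
  proof (rule ccontr)
    assume "y \<notin> V"
    then have "infdist x (- V) \<le> dist x y" by (intro infdist_le) auto
    then show False using y by simp
  qed
qed

text \<open>A point \<open>(t, x)\<close> of the cone region with \<open>t > 0\<close> satisfies \<open>c * t < infdist x (- V)\<close> since \<open>\<alpha> * c < 1\<close>, so it
lies on the axis of a cone over the ball of radius \<open>infdist x (- V)\<close> around \<open>x\<close>, which is contained in \<open>V\<close>.
The points with \<open>t = 0\<close> form a null set.\<close>

lemma cone_disturbance_eq_0:
  assumes g: "\<gamma> > 1" and ent: "entropy_admissible \<gamma> T \<rho> u \<rho>\<^sub>0 u\<^sub>0" and m: "m > 0" and c: "c > 0"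
    and flux: "AE z in lebesgue_on (slab T).
      norm (rel_flux \<gamma> (\<rho> z) (u z)) + m * rel_energy \<gamma> (\<rho> z) (u z) \<le> c * rel_energy \<gamma> (\<rho> z) (u z)"
    and V: "closed V" and rest: "cone_disturbance T \<rho> u \<rho>\<^sub>0 u\<^sub>0 0 V = 0"
    and \<alpha>: "0 < \<alpha>" "\<alpha> * c < 1"
  shows "cone_disturbance T \<rho> u \<rho>\<^sub>0 u\<^sub>0 \<alpha> V = 0"
proof -
  let ?R = "cone_region T V \<alpha>" and ?S = "slab T" and ?f = "\<lambda>z. (\<rho> z - 1, u z)"
  have st: "Linf_state (slab T) \<rho> u" and st0: "Linf_state UNIV \<rho>\<^sub>0 u\<^sub>0"
    using ent by (auto simp add: entropy_admissible_def weak_solution_def)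
  have "Linf_norm V (\<lambda>x. inverse (\<rho>\<^sub>0 x) * (\<rho>\<^sub>0 x - 1)) + Linf_norm V u\<^sub>0 \<le> ennreal 0"
    using rest by (simp add: cone_disturbance_def disturbance_size_def)
  from Linf_norm_sum_le_AE[OF this]
  have "AE x in lebesgue_on V. norm (inverse (\<rho>\<^sub>0 x) * (\<rho>\<^sub>0 x - 1)) + norm (u\<^sub>0 x) \<le> 0" by simp
  moreover have Vm: "V \<in> sets lebesgue" using V by simp
  ultimately have "AE x in lebesgue. x \<in> V \<longrightarrow> norm (inverse (\<rho>\<^sub>0 x) * (\<rho>\<^sub>0 x - 1)) + norm (u\<^sub>0 x) \<le> 0"
    by (simp add: AE_restrict_space_iff)
  moreover have "AE x in lebesgue. \<rho>\<^sub>0 x > 0" using st0 unfolding Linf_state_def lebesgue_on_UNIV_eq by blast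
  ultimately have rest': "AE x in lebesgue. x \<in> V \<longrightarrow> \<rho>\<^sub>0 x = 1 \<and> u\<^sub>0 x = 0"
  proof eventually_elim
    fix x assume *: "x \<in> V \<longrightarrow> norm (inverse (\<rho>\<^sub>0 x) * (\<rho>\<^sub>0 x - 1)) + norm (u\<^sub>0 x) \<le> 0" "\<rho>\<^sub>0 x > 0"
    show "x \<in> V \<longrightarrow> \<rho>\<^sub>0 x = 1 \<and> u\<^sub>0 x = 0"
    proof
      assume "x \<in> V"
      then have "norm (inverse (\<rho>\<^sub>0 x) * (\<rho>\<^sub>0 x - 1)) = 0 \<and> norm (u\<^sub>0 x) = 0"
        using *(1) norm_ge_zero[of "inverse (\<rho>\<^sub>0 x) * (\<rho>\<^sub>0 x - 1)"] norm_ge_zero[of "u\<^sub>0 x"] by linarith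
      then show "\<rho>\<^sub>0 x = 1 \<and> u\<^sub>0 x = 0" using *(2) by simp
    qed
  qed
  have out: "z \<notin> ess_supp ?S ?f" if z: "z \<in> ?R" "fst z \<noteq> 0" for z
  proof -
    obtain t x where tx: "z = (t, x)" by (cases z)
    have t: "0 < t" "t < T" "t \<le> \<alpha> * infdist x (- V)"
      using cone_region_subset[OF \<alpha>(1), of T V] z by (auto simp: tx slab_def)
    have "c * t \<le> (\<alpha> * c) * infdist x (- V)" using mult_left_mono[OF t(3), of c] c by (simp add: mult_ac)
    moreover have "0 < infdist x (- V)" using t \<alpha>(1) by (smt (verit) zero_less_mult_pos)
    ultimately have ct: "c * t < infdist x (- V)" using \<alpha>(2) by (smt (verit) mult_less_cancel_right2)
    have "AE y in lebesgue. y \<in> ball x (infdist x (- V)) \<longrightarrow> \<rho>\<^sub>0 y = 1 \<and> u\<^sub>0 y = 0"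
      using rest' by eventually_elim (use ball_infdist_subset in blast)
    from rest_cone_initial[OF g ent m c flux this _ t(2) ct] show ?thesis using t tx by simp
  qed
  have RS: "?R \<subseteq> ?S" by (auto simp: cone_region_def)
  have Rm: "?R \<in> sets lebesgue" by (rule cone_region_measurable)
  have "AE z in lebesgue. z \<in> ?R \<longrightarrow> \<rho> z = 1 \<and> u z = 0"
    using AE_zero_outside_ess_supp[OF slab_measurable(1)[of T], of ?f] AE_fst_neq[of 0]
    by eventually_elim (use out RS in \<open>auto simp: zero_prod_def\<close>)
  then have ae: "AE z in lebesgue_on ?R. \<rho> z = 1 \<and> u z = 0"
    by (rule AE_restrict_space_iff[THEN iffD2, rotated]) (use Rm in simp)
  have meas: "f \<in> borel_measurable (lebesgue_on ?R)" if "f \<in> borel_measurable (lebesgue_on ?S)" for f :: "spacetime \<Rightarrow> 'b::euclidean_space"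
    by (rule measurable_restrict_mono[OF that RS])
  have [measurable]: "\<rho> \<in> borel_measurable (lebesgue_on ?R)" "u \<in> borel_measurable (lebesgue_on ?R)"
    using st by (auto simp: Linf_state_def intro: meas)
  have "Linf_norm ?R (\<lambda>z. inverse (\<rho> z) * (\<rho> z - 1)) = 0"
    by (rule Linf_norm_eq_0I) (measurable, use ae in \<open>eventually_elim, simp\<close>)
  moreover have "Linf_norm ?R u = 0"
    by (rule Linf_norm_eq_0I) (measurable, use ae in \<open>eventually_elim, simp\<close>)
  ultimately show ?thesis using \<alpha> by (simp add: cone_disturbance_def disturbance_size_def)
qed

lemma flux_bound_AE:
  assumes st: "Linf_state (slab T) \<rho> u" and m: "m > 0"
    and size: "disturbance_size (slab T) \<rho> u \<le> ennreal m"
    and C: "\<And>r v m. r > 0 \<Longrightarrow> \<bar>inverse r * (r - 1)\<bar> + norm v \<le> m \<Longrightarrow>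
       norm (rel_flux \<gamma> r v) + m * rel_energy \<gamma> r v \<le> (1 + C * m) * rel_energy \<gamma> r v"
  shows "AE z in lebesgue_on (slab T).
      norm (rel_flux \<gamma> (\<rho> z) (u z)) + m * rel_energy \<gamma> (\<rho> z) (u z) \<le> (1 + C * m) * rel_energy \<gamma> (\<rho> z) (u z)"
proof -
  have 1: "AE z in lebesgue_on (slab T). norm (inverse (\<rho> z) * (\<rho> z - 1)) + norm (u z) \<le> m"
    by (rule Linf_norm_sum_le_AE) (use size m in \<open>simp_all add: disturbance_size_def\<close>)
  have 2: "AE z in lebesgue_on (slab T). \<rho> z > 0" using st by (simp add: Linf_state_def)
  show ?thesis using 1 2 by eventually_elim (rule C, auto)
qed

text \<open>The disturbance vanishes for every \<open>\<alpha> < inverse (1 + C * m)\<close>, and these values bound the supremum from below.\<close>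

lemma WS_of_flux_bound:
  assumes g: "\<gamma> > 1" and C0: "C > 0"
    and C: "\<And>r v m. r > 0 \<Longrightarrow> \<bar>inverse r * (r - 1)\<bar> + norm v \<le> m \<Longrightarrow>
       norm (rel_flux \<gamma> r v) + m * rel_energy \<gamma> r v \<le> (1 + C * m) * rel_energy \<gamma> r v"
  shows "WS \<gamma> C"
  unfolding WS_def
proof (intro allI impI, elim conjE)
  fix T \<rho> u \<rho>\<^sub>0 u\<^sub>0 m V
  assume ent: "entropy_admissible \<gamma> T \<rho> u \<rho>\<^sub>0 u\<^sub>0" and m: "0 < (m::real)"
    and size: "disturbance_size (slab T) \<rho> u \<le> ennreal m" and V: "closed V"
    and rest: "cone_disturbance T \<rho> u \<rho>\<^sub>0 u\<^sub>0 0 V = 0"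
  let ?A = "{\<alpha>. 0 \<le> \<alpha> \<and> \<alpha> \<le> 1 \<and> cone_disturbance T \<rho> u \<rho>\<^sub>0 u\<^sub>0 \<alpha> V = 0}"
  define c where "c = 1 + C * m"
  have c: "c \<ge> 1" using C0 m by (simp add: c_def)
  have st: "Linf_state (slab T) \<rho> u"
    using ent by (auto simp add: entropy_admissible_def weak_solution_def)
  have flux: "AE z in lebesgue_on (slab T).
      norm (rel_flux \<gamma> (\<rho> z) (u z)) + m * rel_energy \<gamma> (\<rho> z) (u z) \<le> c * rel_energy \<gamma> (\<rho> z) (u z)"
    unfolding c_def by (rule flux_bound_AE[OF st m size C])
  have bdd: "bdd_above ?A" by (rule bdd_aboveI[of _ 1]) auto
  have "inverse c \<le> Sup ?A"
  proof (rule dense_le)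
    fix \<alpha> assume \<alpha>: "\<alpha> < inverse c"
    have Sup0: "0 \<le> Sup ?A" by (rule cSup_upper[OF _ bdd]) (use rest in auto)
    show "\<alpha> \<le> Sup ?A"
    proof (cases "\<alpha> > 0")
      case True
      have "\<alpha> * c < 1" using \<alpha> c by (simp add: field_simps)
      then have "cone_disturbance T \<rho> u \<rho>\<^sub>0 u\<^sub>0 \<alpha> V = 0"
        using c by (intro cone_disturbance_eq_0[OF g ent m _ flux V rest True]) auto
      moreover have "inverse c \<le> 1" using c by (simp add: inverse_le_1_iff)
      ultimately show ?thesis using True \<alpha> by (intro cSup_upper[OF _ bdd]) auto
    qed (use Sup0 in linarith)
  qed
  then show "inverse (1 + C * m) \<le> Sup ?A" by (simp add: c_def)
qed

lemma rest_outside_ball: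
  assumes "ess_supp UNIV (\<lambda>x. (\<rho>' x - 1, u' x)) \<subseteq> {x :: space. norm x \<le> R}"
    and "\<And>y. y \<in> B \<Longrightarrow> R < norm y"
  shows "AE x in lebesgue. x \<in> B \<longrightarrow> (\<rho>' x :: real) = 1 \<and> (u' x :: space) = 0"
proof -
  have "AE x in lebesgue. x \<in> UNIV - ess_supp UNIV (\<lambda>x. (\<rho>' x - 1, u' x)) \<longrightarrow> (\<rho>' x - 1, u' x) = 0"
    by (rule AE_zero_outside_ess_supp) simp
  then show ?thesis
  proof eventually_elim
    fix x assume "x \<in> UNIV - ess_supp UNIV (\<lambda>x. (\<rho>' x - 1, u' x)) \<longrightarrow> (\<rho>' x - 1, u' x) = 0"
    moreover have "x \<notin> ess_supp UNIV (\<lambda>x. (\<rho>' x - 1, u' x))" if "x \<in> B"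
      using assms(1) assms(2)[OF that] by auto
    ultimately show "x \<in> B \<longrightarrow> \<rho>' x = 1 \<and> u' x = 0" by (auto simp: zero_prod_def)
  qed
qed

theorem corollary1:
  fixes \<gamma> :: real
  assumes "\<gamma> > 1"
  shows "\<exists>C>0. WS \<gamma> C \<and>
    (\<forall>T \<rho> u \<rho>\<^sub>0 u\<^sub>0 m c\<^sub>0.
       0 < T \<and> entropy_admissible \<gamma> T \<rho> u \<rho>\<^sub>0 u\<^sub>0 \<and>
       Linf_norm (slab T) (\<lambda>z. inverse (\<rho> z)) < \<infinity> \<and>
       0 < m \<and>
       Linf_norm (slab T) (\<lambda>z. inverse (\<rho> z) * (\<rho> z - 1)) + Linf_norm (slab T) u \<le> ennreal m \<and>
       c\<^sub>0 = 1 + C * m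
       \<longrightarrow>
       (\<forall>R>0. ess_supp UNIV (\<lambda>x. (\<rho>\<^sub>0 x - 1, u\<^sub>0 x)) \<subseteq> {x. norm x \<le> R} \<longrightarrow>
          ess_supp (slab T) (\<lambda>z. (\<rho> z - 1, u z)) \<subseteq> {(t, x) \<in> slab T. norm x \<le> R + c\<^sub>0 * t}) \<and>
       (\<forall>\<sigma> \<rho>\<^sub>\<sigma> u\<^sub>\<sigma>. 0 < \<sigma> \<and> \<sigma> < T \<and> lebesgue_value T \<rho> u \<sigma> \<rho>\<^sub>\<sigma> u\<^sub>\<sigma> \<longrightarrow>
          (\<forall>R>0. ess_supp UNIV (\<lambda>x. (\<rho>\<^sub>\<sigma> x - 1, u\<^sub>\<sigma> x)) \<subseteq> {x. norm x \<le> R} \<longrightarrow>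
             ess_supp (slab T) (\<lambda>z. (\<rho> z - 1, u z)) \<inter> {\<sigma><..<T} \<times> UNIV
               \<subseteq> {(t, x) \<in> {\<sigma><..<T} \<times> UNIV. norm x \<le> R + c\<^sub>0 * (t - \<sigma>)})))"
proof -
  obtain C where C0: "C > 0" and C: "\<And>r v m. r > 0 \<Longrightarrow> \<bar>inverse r * (r - 1)\<bar> + norm v \<le> m \<Longrightarrow>
       norm (rel_flux \<gamma> r v) + m * rel_energy \<gamma> r v \<le> (1 + C * m) * rel_energy \<gamma> r v"
    using rel_flux_le_rel_energy[OF assms] by metis
  show ?thesis
  proof (intro exI[of _ C] conjI C0 WS_of_flux_bound[OF assms C0 C] allI impI)
    fix T \<rho> u \<rho>\<^sub>0 u\<^sub>0 m c\<^sub>0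
    assume *: "0 < T \<and> entropy_admissible \<gamma> T \<rho> u \<rho>\<^sub>0 u\<^sub>0 \<and>
       Linf_norm (slab T) (\<lambda>z. inverse (\<rho> z)) < \<infinity> \<and> 0 < m \<and>
       Linf_norm (slab T) (\<lambda>z. inverse (\<rho> z) * (\<rho> z - 1)) + Linf_norm (slab T) u \<le> ennreal m \<and>
       c\<^sub>0 = 1 + C * m"
    let ?E = "ess_supp (slab T) (\<lambda>z. (\<rho> z - 1, u z))"
    have ent: "entropy_admissible \<gamma> T \<rho> u \<rho>\<^sub>0 u\<^sub>0" and m: "m > 0" and c0: "c\<^sub>0 = 1 + C * m"
      and size: "disturbance_size (slab T) \<rho> u \<le> ennreal m"
      using * by (auto simp: disturbance_size_def)
    have st: "Linf_state (slab T) \<rho> u"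
      using ent by (auto simp add: entropy_admissible_def weak_solution_def)
    have c: "c\<^sub>0 > 0" using C0 m by (simp add: c0 add_pos_pos)
    note flux = flux_bound_AE[OF st m size C, folded c0]
    have E: "?E \<subseteq> slab T" by (auto simp: ess_supp_def)
    fix R :: real assume R: "R > 0"
    {
      assume supp: "ess_supp UNIV (\<lambda>x. (\<rho>\<^sub>0 x - 1, u\<^sub>0 x)) \<subseteq> {x. norm x \<le> R}"
      have "norm x \<le> R + c\<^sub>0 * t" if z: "(t, x) \<in> ?E" for t x
      proof (rule ccontr)
        assume "\<not> norm x \<le> R + c\<^sub>0 * t"
        then have ct: "c\<^sub>0 * t < norm x - R" by simp
        have t: "0 \<le> t" "t < T" using z E by (auto simp: slab_def)
        have "R < norm y" if "y \<in> ball x (norm x - R)" for y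
          using that norm_triangle_ineq2[of x y] by (simp add: dist_norm)
        then have "AE y in lebesgue. y \<in> ball x (norm x - R) \<longrightarrow> \<rho>\<^sub>0 y = 1 \<and> u\<^sub>0 y = 0"
          by (rule rest_outside_ball[OF supp])
        from rest_cone_initial[OF assms ent m c flux this t ct] z show False by simp
      qed
      then show "?E \<subseteq> {(t, x) \<in> slab T. norm x \<le> R + c\<^sub>0 * t}" using E by auto
    }
    fix \<sigma> \<rho>\<^sub>\<sigma> u\<^sub>\<sigma>
    assume leb: "0 < \<sigma> \<and> \<sigma> < T \<and> lebesgue_value T \<rho> u \<sigma> \<rho>\<^sub>\<sigma> u\<^sub>\<sigma>"
    assume supp: "ess_supp UNIV (\<lambda>x. (\<rho>\<^sub>\<sigma> x - 1, u\<^sub>\<sigma> x)) \<subseteq> {x. norm x \<le> R}"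
    have "norm x \<le> R + c\<^sub>0 * (t - \<sigma>)" if z: "(t, x) \<in> ?E" and t: "\<sigma> < t" "t < T" for t x
    proof (rule ccontr)
      assume "\<not> norm x \<le> R + c\<^sub>0 * (t - \<sigma>)"
      then have "c\<^sub>0 * (t - \<sigma>) < norm x - R" by simp
      \<comment> \<open>A slightly smaller radius, so that the closed ball is at rest as well.\<close>
      from dense[OF this] obtain r where r: "c\<^sub>0 * (t - \<sigma>) < r" "r < norm x - R" by blast
      have "R < norm y" if "y \<in> cball x r" for y
        using that r norm_triangle_ineq2[of x y] by (simp add: dist_norm)
      then have "AE y in lebesgue. y \<in> cball x r \<longrightarrow> \<rho>\<^sub>\<sigma> y = 1 \<and> u\<^sub>\<sigma> y = 0"
        by (rule rest_outside_ball[OF supp])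
      from rest_cone_lebesgue_time[OF assms ent m c flux _ this t r(1)] leb z show False by simp
    qed
    then show "?E \<inter> {\<sigma><..<T} \<times> UNIV \<subseteq> {(t, x) \<in> {\<sigma><..<T} \<times> UNIV. norm x \<le> R + c\<^sub>0 * (t - \<sigma>)}" by auto
  qed
qed

end
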